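(* Let $X^1$ and $X^2$ be finite graphs of objects (with respect to a fixed triple $(\mathcal{C},\mathcal{M}_1,\mathcal{M}_2)$) which are both covered by a tree of objects $X$. If $\operatorname{Aut}(X)$ has finite edge isotropy groups, then $X^1$ and $X^2$ have a common finite cover, i.e. there is a finite graph of objects which is a cover of both $X^1$ and $X^2$.
   Context: Graphs. A graph $G$ consists of a vertex set $V(G)$, an edge set $E(G)$ (of oriented edges), maps $\partial_0,\partial_1:E(G)\to V(G)$ (initial and terminal vertex), and an involution $e\mapsto\overline{e}$ on $E(G)$ with $e\neq\overline{e}$, $\partial_0 e=\partial_1\overline{e}$ and $\partial_0\overline{e}=\partial_1 e$. Graph morphisms preserve $\partial_0,\partial_1$ and edge inversion; automorphisms are morphisms from a graph to itself bijective on vertices and edges. For $v\in V(G)$, $\mathrm{star}(v)=\{e\in E(G)\mid\partial_0e=v\}$. A graph morphism $\alpha:G_1\to G_2$ is a covering if it is surjective and the induced maps $\mathrm{star}(v)\to\mathrm{star}(\alpha(v))$ are bijections for all $v\in V(G_1)$. Graphs of objects. Let $\mathcal{C}$ be a category and let $\mathcal{M}_1\subset\mathcal{M}_2\subset\mathrm{Hom}(\mathcal{C})$ be such that $(\mathrm{Ob}(\mathcal{C}),\mathcal{M}_1)$ and $(\mathrm{Ob}(\mathcal{C}),\mathcal{M}_2)$ are subcategories, with $(\mathrm{Ob}(\mathcal{C}),\mathcal{M}_1)$ a groupoid (all its morphisms are invertible within it). A graph of objects $X$ with respect to $(\mathcal{C},\mathcal{M}_1,\mathcal{M}_2)$ consists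 of: a graph $G_X$; objects $X_v\in\mathrm{Ob}(\mathcal{C})$ for $v\in V(G_X)$; objects $X_e\in\mathrm{Ob}(\mathcal{C})$ for $e\in E(G_X)$ with $X_e=X_{\overline{e}}$; and morphisms $\phi^e_0:X_e\to X_{\partial_0e}$ and $\phi^e_1:X_e\to X_{\partial_1e}$ in $\mathcal{M}_2$ for $e\in E(G_X)$, such that $\phi^e_0=\phi^{\overline{e}}_1$ and $\phi^e_1=\phi^{\overline{e}}_0$. $X$ is finite if $G_X$ is finite, and is a tree of objects if $G_X$ is a tree. A morphism $f:X\to Y$ of graphs of objects (with respect to the same triple) consists of a graph morphism $\hat f:G_X\to G_Y$, morphisms $f_v:X_v\to Y_{\hat f(v)}$ in $\mathcal{M}_1$ for $v\in V(G_X)$, and morphisms $f_e:X_e\to Y_{\hat f(e)}$ in $\mathcal{M}_1$ for $e\in E(G_X)$, such that $f_e=f_{\overline{e}}$ and, for every edge $e$ from $u$ to $v$, $f_u\phi^e_0=\phi^{\hat f(e)}_0f_e$ and $f_v\phi^e_1=\phi^{\hat f(e)}_1f_e$. Composition is componentwise. $f$ is a covering (and $X$ is a cover of $Y$; $Y$ is covered by $X$) if $\hat f$ is a covering of graphs. A morphism $f:X\to X$ is an automorphism if $\hat f$ is a graph automorphism; $\operatorname{Aut}(X)$ is the group of automorphisms. Isotropy groups. For $H\leqslant\operatorname{Aut}(X)$ and $e\in E(G_X)$, the isotropy group of $e$ in $H$ is $H(e):=\{h_e\mid h\in H,\ \hat h(e)=e\}\leqslant\operatorname{Aut}_{\mathcal{M}_1}(X_e)$,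 where $\operatorname{Aut}_{\mathcal{M}_1}(X_e)$ is the group of morphisms $X_e\to X_e$ in $\mathcal{M}_1$. $H$ has finite edge isotropy groups if $H(e)$ is finite for every $e\in E(G_X)$. *)

theory Defs
  imports "Graph_Theory.Graph_Theory"
begin

section \<open>Categories\<close>

record ('o, 'm) category =
  objs :: "'o set"
  mors :: "'m set"
  src :: "'m \<Rightarrow> 'o"
  tgt :: "'m \<Rightarrow> 'o"
  ident :: "'o \<Rightarrow> 'm"
  cmp :: "'m \<Rightarrow> 'm \<Rightarrow> 'm"

text \<open>\<open>cmp C g f\<close> is the composite "g after f"; it is meaningful only if \<open>tgt C f = src C g\<close>.\<close>

definition homset :: "('o, 'm) category \<Rightarrow> 'm set \<Rightarrow> 'o \<Rightarrow> 'o \<Rightarrow> 'm set" where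
  "homset C M a b = {m \<in> M. src C m = a \<and> tgt C m = b}"

locale category =
  fixes C :: "('o, 'm) category"
  assumes src_in_objs: "f \<in> mors C \<Longrightarrow> src C f \<in> objs C"
    and tgt_in_objs: "f \<in> mors C \<Longrightarrow> tgt C f \<in> objs C"
    and ident_in_hom: "a \<in> objs C \<Longrightarrow> ident C a \<in> homset C (mors C) a a"
    and cmp_in_hom:
      "f \<in> homset C (mors C) a b \<Longrightarrow> g \<in> homset C (mors C) b c
        \<Longrightarrow> cmp C g f \<in> homset C (mors C) a c"
    and cmp_ident_right: "f \<in> mors C \<Longrightarrow> cmp C f (ident C (src C f)) = f"
    and cmp_ident_left: "f \<in> mors C \<Longrightarrow> cmp C (ident C (tgt C f)) f = f"
    and cmp_assoc:
      "f \<in> homset C (mors C) a b \<Longrightarrow> g \<in> homset C (mors C) b c \<Longrightarrow> h \<in> homset C (mors C) c d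
        \<Longrightarrow> cmp C h (cmp C g f) = cmp C (cmp C h g) f"

text \<open>\<open>(objs C, M)\<close> is a (wide) subcategory of \<open>C\<close>.\<close>

definition wide_subcategory :: "('o, 'm) category \<Rightarrow> 'm set \<Rightarrow> bool" where
  "wide_subcategory C M \<longleftrightarrow>
     M \<subseteq> mors C \<and>
     (\<forall>a \<in> objs C. ident C a \<in> M) \<and>
     (\<forall>f \<in> M. \<forall>g \<in> M. tgt C f = src C g \<longrightarrow> cmp C g f \<in> M)"

definition wide_subgroupoid :: "('o, 'm) category \<Rightarrow> 'm set \<Rightarrow> bool" where
  "wide_subgroupoid C M \<longleftrightarrow>
     wide_subcategory C M \<and>
     (\<forall>f \<in> M. \<exists>g \<in> homset C M (tgt C f) (src C f).
        cmp C g f = ident C (src C f) \<and> cmp C f g = ident C (tgt C f))"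

locale category_triple = category C
  for C :: "('o, 'm) category" +
  fixes M1 M2 :: "'m set"
  assumes M1_subset_M2: "M1 \<subseteq> M2"
    and groupoid_M1: "wide_subgroupoid C M1"
    and subcategory_M2: "wide_subcategory C M2"


section \<open>Graphs, trees and coverings\<close>

text \<open>
  A graph with oriented edges and a fixed-point free edge inversion is a
  \<^locale>\<open>bidirected_digraph\<close>; \<open>tail\<close> and \<open>head\<close> are the initial and terminal vertex, and
  \<open>out_arcs G v\<close> is the star of \<open>v\<close>. By the library's convention the inversion is the identity
  outside \<open>arcs G\<close>.
\<close>

text \<open>
  The library's \<^const>\<open>tree\<close> is not usable here, because an edge followed by its own inverse
  is a \<open>cycle\<close> in the library's sense. Circuits are the cycles without such backtracking.
  Trees are nonempty, as \<^const>\<open>connected\<close> includes nonemptiness.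
\<close>

definition circuit :: "('v, 'e) pre_digraph \<Rightarrow> ('e \<Rightarrow> 'e) \<Rightarrow> 'e list \<Rightarrow> bool" where
  "circuit G bar p \<longleftrightarrow> pre_digraph.cycle G p \<and> successively (\<lambda>a b. b \<noteq> bar a) p"

definition bidirected_tree :: "('v, 'e) pre_digraph \<Rightarrow> ('e \<Rightarrow> 'e) \<Rightarrow> bool" where
  "bidirected_tree G bar \<longleftrightarrow>
     bidirected_digraph G bar \<and> connected G \<and> \<not> (\<exists>p. circuit G bar p)"

definition graph_morphism ::
    "('v, 'e) pre_digraph \<Rightarrow> ('e \<Rightarrow> 'e) \<Rightarrow> ('w, 'd) pre_digraph \<Rightarrow> ('d \<Rightarrow> 'd)
      \<Rightarrow> ('v \<Rightarrow> 'w) \<Rightarrow> ('e \<Rightarrow> 'd) \<Rightarrow> bool" where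
  "graph_morphism G barG H barH fv fe \<longleftrightarrow>
     (\<forall>v \<in> verts G. fv v \<in> verts H) \<and>
     (\<forall>e \<in> arcs G. fe e \<in> arcs H \<and>
        tail H (fe e) = fv (tail G e) \<and>
        head H (fe e) = fv (head G e) \<and>
        fe (barG e) = barH (fe e))"

definition graph_covering ::
    "('v, 'e) pre_digraph \<Rightarrow> ('e \<Rightarrow> 'e) \<Rightarrow> ('w, 'd) pre_digraph \<Rightarrow> ('d \<Rightarrow> 'd)
      \<Rightarrow> ('v \<Rightarrow> 'w) \<Rightarrow> ('e \<Rightarrow> 'd) \<Rightarrow> bool" where
  "graph_covering G barG H barH fv fe \<longleftrightarrow>
     graph_morphism G barG H barH fv fe \<and>
     fv ` verts G = verts H \<and> fe ` arcs G = arcs H \<and>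
     (\<forall>v \<in> verts G. bij_betw fe (out_arcs G v) (out_arcs H (fv v)))"

definition graph_automorphism ::
    "('v, 'e) pre_digraph \<Rightarrow> ('e \<Rightarrow> 'e) \<Rightarrow> ('v \<Rightarrow> 'v) \<Rightarrow> ('e \<Rightarrow> 'e) \<Rightarrow> bool" where
  "graph_automorphism G bar fv fe \<longleftrightarrow>
     graph_morphism G bar G bar fv fe \<and>
     bij_betw fv (verts G) (verts G) \<and> bij_betw fe (arcs G) (arcs G)"


section \<open>Graphs of objects\<close>

record ('v, 'e, 'o, 'm) graph_of_objs =
  grph :: "('v, 'e) pre_digraph"
  einv :: "'e \<Rightarrow> 'e"
  vobj :: "'v \<Rightarrow> 'o"
  eobj :: "'e \<Rightarrow> 'o"
  phi0 :: "'e \<Rightarrow> 'm"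
  phi1 :: "'e \<Rightarrow> 'm"

definition is_graph_of_objs ::
    "('o, 'm) category \<Rightarrow> 'm set \<Rightarrow> ('v, 'e, 'o, 'm) graph_of_objs \<Rightarrow> bool" where
  "is_graph_of_objs C M2 X \<longleftrightarrow>
     bidirected_digraph (grph X) (einv X) \<and>
     (\<forall>v \<in> verts (grph X). vobj X v \<in> objs C) \<and>
     (\<forall>e \<in> arcs (grph X).
        eobj X e \<in> objs C \<and>
        eobj X (einv X e) = eobj X e \<and>
        phi0 X e \<in> homset C M2 (eobj X e) (vobj X (tail (grph X) e)) \<and>
        phi1 X e \<in> homset C M2 (eobj X e) (vobj X (head (grph X) e)) \<and>
        phi0 X e = phi1 X (einv X e) \<and>
        phi1 X e = phi0 X (einv X e))"

definition is_finite_graph_of_objs ::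
    "('o, 'm) category \<Rightarrow> 'm set \<Rightarrow> ('v, 'e, 'o, 'm) graph_of_objs \<Rightarrow> bool" where
  "is_finite_graph_of_objs C M2 X \<longleftrightarrow> is_graph_of_objs C M2 X \<and> fin_digraph (grph X)"

definition is_tree_of_objs ::
    "('o, 'm) category \<Rightarrow> 'm set \<Rightarrow> ('v, 'e, 'o, 'm) graph_of_objs \<Rightarrow> bool" where
  "is_tree_of_objs C M2 X \<longleftrightarrow> is_graph_of_objs C M2 X \<and> bidirected_tree (grph X) (einv X)"

record ('v, 'e, 'w, 'd, 'm) goo_map =
  vmap :: "'v \<Rightarrow> 'w"
  emap :: "'e \<Rightarrow> 'd"
  vmor :: "'v \<Rightarrow> 'm"
  emor :: "'e \<Rightarrow> 'm"

definition goo_morphism ::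
    "('o, 'm) category \<Rightarrow> 'm set \<Rightarrow> ('v, 'e, 'o, 'm) graph_of_objs \<Rightarrow>
      ('w, 'd, 'o, 'm) graph_of_objs \<Rightarrow> ('v, 'e, 'w, 'd, 'm) goo_map \<Rightarrow> bool" where
  "goo_morphism C M1 X Y f \<longleftrightarrow>
     graph_morphism (grph X) (einv X) (grph Y) (einv Y) (vmap f) (emap f) \<and>
     (\<forall>v \<in> verts (grph X). vmor f v \<in> homset C M1 (vobj X v) (vobj Y (vmap f v))) \<and>
     (\<forall>e \<in> arcs (grph X).
        emor f e \<in> homset C M1 (eobj X e) (eobj Y (emap f e)) \<and>
        emor f (einv X e) = emor f e \<and>
        cmp C (vmor f (tail (grph X) e)) (phi0 X e) = cmp C (phi0 Y (emap f e)) (emor f e) \<and>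
        cmp C (vmor f (head (grph X) e)) (phi1 X e) = cmp C (phi1 Y (emap f e)) (emor f e))"

definition goo_covering ::
    "('o, 'm) category \<Rightarrow> 'm set \<Rightarrow> ('v, 'e, 'o, 'm) graph_of_objs \<Rightarrow>
      ('w, 'd, 'o, 'm) graph_of_objs \<Rightarrow> ('v, 'e, 'w, 'd, 'm) goo_map \<Rightarrow> bool" where
  "goo_covering C M1 X Y f \<longleftrightarrow>
     goo_morphism C M1 X Y f \<and>
     graph_covering (grph X) (einv X) (grph Y) (einv Y) (vmap f) (emap f)"

definition is_cover_of ::
    "('o, 'm) category \<Rightarrow> 'm set \<Rightarrow> ('v, 'e, 'o, 'm) graph_of_objs \<Rightarrow>
      ('w, 'd, 'o, 'm) graph_of_objs \<Rightarrow> bool" where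
  "is_cover_of C M1 X Y \<longleftrightarrow> (\<exists>f. goo_covering C M1 X Y f)"

text \<open>
  The components of a \<open>goo_map\<close> are total functions whose values outside the vertex and edge
  sets are irrelevant, so the set below contains every representative of each automorphism. The
  isotropy groups only see values at edges of \<open>X\<close>, hence do not depend on the representatives.
\<close>

definition goo_Aut ::
    "('o, 'm) category \<Rightarrow> 'm set \<Rightarrow> ('v, 'e, 'o, 'm) graph_of_objs \<Rightarrow>
      ('v, 'e, 'v, 'e, 'm) goo_map set" where
  "goo_Aut C M1 X =
     {h. goo_morphism C M1 X X h \<and>
         graph_automorphism (grph X) (einv X) (vmap h) (emap h)}"

definition edge_isotropy :: "('v, 'e, 'v, 'e, 'm) goo_map set \<Rightarrow> 'e \<Rightarrow> 'm set" where
  "edge_isotropy H e = {emor h e | h. h \<in> H \<and> emap h e = e}"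

definition finite_edge_isotropy ::
    "('v, 'e, 'o, 'm) graph_of_objs \<Rightarrow> ('v, 'e, 'v, 'e, 'm) goo_map set \<Rightarrow> bool" where
  "finite_edge_isotropy X H \<longleftrightarrow> (\<forall>e \<in> arcs (grph X). finite (edge_isotropy H e))"

end

theory Submission
  imports Defs
begin

text \<open>
  The proof is a counting version of Leighton's theorem. Fix a covering \<open>p\<close> of \<open>X1\<close> by the tree
  \<open>X\<close>, and let \<open>q\<close> range over all coverings of \<open>X2\<close> by \<open>X\<close>. At an edge \<open>e\<close> of \<open>X\<close> such a \<open>q\<close>
  leaves a trace on \<open>X1\<close> and \<open>X2\<close>: the edges \<open>p e\<close> and \<open>q e\<close> together with the isomorphism
  \<open>q\<^sub>e \<circ> p\<^sub>e\<inverse>\<close> between their objects. Call this triple an edge germ, and call the pair of vertices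
  \<open>p v\<close>, \<open>q v\<close> together with the edge germs at all edges issuing from \<open>v\<close> a star germ. A common
  finite cover is built from copies of star germs as vertices and copies of edge germs as
  edges. A star germ contains exactly one edge germ over each edge at its vertex in \<open>X1\<close>, and
  likewise for \<open>X2\<close>, so that such a complex automatically covers both. What has to be arranged is
  finiteness and the gluing: every edge germ must occur equally often at its two ends.

  Everything rests on one lifting principle (\<open>goo_covering_lift\<close>): if two coverings
  \<open>r\<close>, \<open>q\<close> of the same graph of objects by the tree \<open>X\<close> satisfy \<open>r x = q x'\<close> for vertices \<open>x\<close>, \<open>x'\<close>,
  then \<open>r = q \<circ> g\<close> for an automorphism \<open>g\<close> of \<open>X\<close> taking \<open>x\<close> to \<open>x'\<close>. Applied to \<open>p\<close> twice it yields the deck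
  transformations, so that germs over a vertex or edge of \<open>X1\<close> may all be read off at one fixed
  lift. Applied to two coverings of \<open>X2\<close> with the same value at \<open>e\<close>, it says that their
  morphisms at \<open>e\<close> differ by an element of the isotropy group of \<open>e\<close>; hence there are only
  finitely many germs (\<open>finite_edge_germs\<close>). It also gives homogeneity
  (\<open>card_star_germs_containing_le\<close>): two edge germs \<open>q e\<close>, \<open>q' e\<close> over the same edge of \<open>X1\<close>
  lie in equally many star germs, because a star germ containing the first is that of
  \<open>q \<circ> g\<close> for some \<open>g\<close> fixing \<open>e\<close> and acting trivially on its object, and can be replaced by that
  of \<open>q' \<circ> g\<close>.

  Now give every star germ over a vertex \<open>u\<close> the weight \<open>1 / s(u)\<close>, where \<open>s(u)\<close> is the number of
  star germs over \<open>u\<close>. By homogeneity the total weight of the star germs containing a given edge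
  germ over \<open>d\<close> is \<open>1 / n(d)\<close>, where \<open>n(d)\<close> is the number of edge germs over \<open>d\<close>. Reversing edges
  shows that \<open>d\<close> and its inverse have the same \<open>n\<close>, so that the weights match at both ends of every
  edge. Multiplying by a common denominator makes them integral multiplicities
  (\<open>balanced_labelling\<close>), with which the complex can be glued (\<open>common_finite_cover\<close>).
\<close>


section \<open>Lifting walks from a tree\<close>

lemma not_successively_decomp:
  "\<not> successively P xs \<Longrightarrow> \<exists>as x y bs. xs = as @ x # y # bs \<and> \<not> P x y"
proof (induction P xs rule: successively.induct)
  case (3 P x y xs)
  then show ?case
    by (metis append_Cons append_Nil successively.simps(3))
qed auto

text \<open>
  A closed walk of minimal length is a cycle, and in a tree every cycle contains an edge
  followed by its inverse. A closed walk that revisits a vertex in between contains a shorter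
  closed walk, to which induction applies.
\<close>

lemma closed_walk_backtracks:
  assumes "bidirected_tree G bar" "pre_digraph.awalk G u w u" "w \<noteq> []"
  shows "\<exists>as e bs. w = as @ e # bar e # bs"
  using assms(2,3)
proof (induction "length w" arbitrary: u w rule: less_induct)
  case less
  interpret bidirected_digraph G bar
    using assms(1) by (simp add: bidirected_tree_def)
  show ?case
  proof (cases "distinct (tl (awalk_verts u w))")
    case True
    then have "cycle w"
      using less.prems by (auto simp: cycle_def)
    then have "\<not> successively (\<lambda>a b. b \<noteq> bar a) w"
      using assms(1) by (auto simp: bidirected_tree_def circuit_def)
    then show ?thesis
      using not_successively_decomp by blast
  next
    case False
    obtain e es where w: "w = e # es"
      using less.prems(2) by (cases w) auto
    have "awalk (head G e) es u" "\<not> distinct (awalk_verts (head G e) es)"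
      using less.prems(1) False by (auto simp: w awalk_Cons_iff)
    then obtain q r s x where es: "es = q @ r @ s" "0 < length r" "awalk x r x"
      using awalk_not_distinct_decomp[of "head G e" es u] by metis
    then obtain as d bs where "r = as @ d # bar d # bs"
      using less.hyps[of r x] by (auto simp: w)
    then have "w = (e # q @ as) @ d # bar d # (bs @ s)"
      by (simp add: w es)
    then show ?thesis by blast
  qed
qed

lemma (in bidirected_digraph) awalk_rev:
  "awalk u w v \<Longrightarrow> awalk v (rev (map arev w)) u"
proof (induction w arbitrary: u)
  case Nil
  then show ?case by (auto simp: awalk_Nil_iff)
next
  case (Cons e w)
  then have e: "e \<in> arcs G" "u = tail G e" "awalk (head G e) w v"
    by (auto simp: awalk_Cons_iff)
  have "awalk (head G e) [arev e] u"
    using e by (simp add: awalk_simps)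
  with Cons.IH[OF e(3)] show ?case
    by (simp add: awalk_appendI)
qed

lemma graph_covering_simps:
  assumes "graph_covering G bar H barH pv pe"
  shows "v \<in> verts G \<Longrightarrow> pv v \<in> verts H"
    and "e \<in> arcs G \<Longrightarrow> pe e \<in> arcs H"
    and "e \<in> arcs G \<Longrightarrow> tail H (pe e) = pv (tail G e)"
    and "e \<in> arcs G \<Longrightarrow> head H (pe e) = pv (head G e)"
    and "e \<in> arcs G \<Longrightarrow> pe (bar e) = barH (pe e)"
  using assms by (auto simp: graph_covering_def graph_morphism_def)

lemma graph_covering_star_inj:
  assumes "graph_covering G bar H barH pv pe" "wf_digraph G"
    "e \<in> arcs G" "e' \<in> arcs G" "tail G e = tail G e'" "pe e = pe e'"
  shows "e = e'"
proof -
  have "inj_on pe (out_arcs G (tail G e))"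
    using assms(1-3) wf_digraph.tail_in_verts[OF assms(2,3)]
    by (auto simp: graph_covering_def bij_betw_def)
  then show ?thesis
    using assms by (auto simp: inj_on_def)
qed

lemma graph_covering_star_surj:
  assumes "graph_covering G bar H barH pv pe" "v \<in> verts G"
    "d \<in> arcs H" "tail H d = pv v"
  obtains e where "e \<in> arcs G" "tail G e = v" "pe e = d"
proof -
  have "pe ` out_arcs G v = out_arcs H (pv v)"
    using assms(1,2) by (auto simp: graph_covering_def bij_betw_def)
  then have "d \<in> pe ` out_arcs G v"
    using assms by auto
  then show ?thesis using that by auto
qed

text \<open>
  This is the triviality of the fundamental group of a tree: a closed walk can be cancelled down to
  the empty walk by removing backtracks, and since \<open>q\<close> is injective on stars, a backtrack of \<open>w\<close>
  forces a backtrack of the walk \<open>w'\<close> with the same image.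
\<close>

lemma closed_walk_lifts_closed:
  assumes tree: "bidirected_tree G bar"
    and bidir: "bidirected_digraph G' bar'"
    and p: "graph_covering G bar H barH pv pe"
    and q: "graph_covering G' bar' H barH qv qe"
    and "pre_digraph.awalk G u w u" "pre_digraph.awalk G' u' w' v'"
    and "map pe w = map qe w'"
  shows "v' = u'"
  using assms(5-7)
proof (induction "length w" arbitrary: w w' rule: less_induct)
  case less
  interpret G: bidirected_digraph G bar
    using tree by (simp add: bidirected_tree_def)
  interpret G': bidirected_digraph G' bar'
    by (fact bidir)
  show ?case
  proof (cases "w = []")
    case True
    then show ?thesis
      using less.prems by (auto simp: G'.awalk_Nil_iff)
  next
    case False
    then obtain as e bs where w: "w = as @ e # bar e # bs"
      using closed_walk_backtracks[OF tree less.prems(1)] by blast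
    then obtain as' e' f' bs' where w': "w' = as' @ e' # f' # bs'"
      and maps: "map pe as = map qe as'" "pe e = qe e'" "pe (bar e) = qe f'" "map pe bs = map qe bs'"
      using less.prems(3) by (fastforce simp: append_eq_map_conv Cons_eq_map_conv)
    have e: "e \<in> arcs G" "G.awalk u as (tail G e)" "G.awalk (tail G e) bs u"
      using less.prems(1) by (auto simp: w G.awalk_Cons_iff)
    have e': "e' \<in> arcs G'" "f' \<in> arcs G'" "head G' e' = tail G' f'"
      "G'.awalk u' as' (tail G' e')" "G'.awalk (head G' f') bs' v'"
      using less.prems(2) by (auto simp: w' G'.awalk_Cons_iff)
    have "qe f' = qe (bar' e')"
      using maps graph_covering_simps(5)[OF p e(1)] graph_covering_simps(5)[OF q e'(1)] by simp
    \<comment> \<open>Both edges issue from the terminal vertex of \<open>e'\<close> and have the same image.\<close>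
    then have "f' = bar' e'"
      using graph_covering_star_inj[OF q G'.wf_digraph_axioms, of f' "bar' e'"] e' by simp
    then have "G'.awalk u' (as' @ bs') v'"
      using e' by (intro G'.awalk_appendI[of _ _ "tail G' e'"]) auto
    moreover have "G.awalk u (as @ bs) u"
      using e by (intro G.awalk_appendI[of _ _ "tail G e"]) auto
    ultimately show ?thesis
      using less.hyps[of "as @ bs" "as' @ bs'"] maps by (simp add: w)
  qed
qed

text \<open>
  Since \<open>x\<close> and \<open>x'\<close> have the same image, this relation is the component of \<open>(x, x')\<close> in the
  fibre product of the two coverings. It will turn out to be the graph of an automorphism.
\<close>

definition parallel_walks where
  "parallel_walks G pe qe x x' u u' \<longleftrightarrow>
     (\<exists>w w'. pre_digraph.awalk G x w u \<and> pre_digraph.awalk G x' w' u' \<and> map pe w = map qe w')"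

lemma parallel_walks_commute:
  "parallel_walks G pe qe x x' u u' \<longleftrightarrow> parallel_walks G qe pe x' x u' u"
  unfolding parallel_walks_def by metis

text \<open>
  Going back along the first walk and out again along the second one is a closed walk at \<open>u\<close>;
  its counterpart runs from \<open>u1\<close> to \<open>u2\<close> and is therefore closed.
\<close>

lemma parallel_walks_unique:
  assumes tree: "bidirected_tree G bar"
    and p: "graph_covering G bar H barH pv pe"
    and q: "graph_covering G bar H barH qv qe"
    and "parallel_walks G pe qe x x' u u1" "parallel_walks G pe qe x x' u u2"
  shows "u1 = u2"
proof -
  interpret bidirected_digraph G bar
    using tree by (simp add: bidirected_tree_def)
  obtain w1 w1' w2 w2' where
    1: "awalk x w1 u" "awalk x' w1' u1" "map pe w1 = map qe w1'" and
    2: "awalk x w2 u" "awalk x' w2' u2" "map pe w2 = map qe w2'"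
    using assms(4,5) unfolding parallel_walks_def by blast
  have "map pe (map bar w1) = map barH (map pe w1)"
    using 1(1) graph_covering_simps(5)[OF p] by (auto simp: awalk_def)
  moreover have "map qe (map bar w1') = map barH (map qe w1')"
    using 1(2) graph_covering_simps(5)[OF q] by (auto simp: awalk_def)
  ultimately have "map pe (rev (map bar w1)) = map qe (rev (map bar w1'))"
    using 1(3) by (metis rev_map)
  then have "map pe (rev (map bar w1) @ w2) = map qe (rev (map bar w1') @ w2')"
    using 2(3) by simp
  moreover have "awalk u (rev (map bar w1) @ w2) u" "awalk u1 (rev (map bar w1') @ w2') u2"
    using 1 2 awalk_rev awalk_appendI by blast+
  ultimately show ?thesis
    using closed_walk_lifts_closed[OF tree bidirected_digraph_axioms p q] by blast
qed

lemma walk_lifting: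
  assumes "bidirected_digraph G bar"
    and p: "graph_covering G bar H barH pv pe"
    and q: "graph_covering G bar H barH qv qe"
    and "pre_digraph.awalk G x w u" "x' \<in> verts G" "pv x = qv x'"
  shows "\<exists>w' u'. pre_digraph.awalk G x' w' u' \<and> map pe w = map qe w'"
  using assms(4-6)
proof (induction w arbitrary: x x')
  case Nil
  interpret bidirected_digraph G bar by fact
  from Nil show ?case by (auto simp: awalk_Nil_iff)
next
  case (Cons e w)
  interpret bidirected_digraph G bar by fact
  have e: "e \<in> arcs G" "tail G e = x" "awalk (head G e) w u"
    using Cons.prems by (auto simp: awalk_Cons_iff)
  then obtain e' where e': "e' \<in> arcs G" "tail G e' = x'" "qe e' = pe e"
    using graph_covering_star_surj[OF q Cons.prems(2), of "pe e"]
      graph_covering_simps[OF p] Cons.prems by metis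
  then have "pv (head G e) = qv (head G e')"
    using graph_covering_simps(4)[OF p e(1)] graph_covering_simps(4)[OF q e'(1)] by simp
  then obtain w' u' where "awalk (head G e') w' u'" "map pe w = map qe w'"
    using Cons.IH[OF e(3) head_in_verts[OF e'(1)]] by blast
  then have "awalk x' (e' # w') u' \<and> map pe (e # w) = map qe (e' # w')"
    using e' by (simp add: awalk_Cons_iff)
  then show ?case by blast
qed

lemma parallel_walks_total:
  assumes tree: "bidirected_tree G bar"
    and p: "graph_covering G bar H barH pv pe"
    and q: "graph_covering G bar H barH qv qe"
    and "x \<in> verts G" "x' \<in> verts G" "pv x = qv x'" "u \<in> verts G"
  shows "\<exists>u'. parallel_walks G pe qe x x' u u'"
proof -
  interpret bidirected_digraph G bar
    using tree by (simp add: bidirected_tree_def)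
  have "strongly_connected G"
    using tree symmetric_connected_imp_strongly_connected sym_arcs
    by (auto simp: bidirected_tree_def)
  then have "x \<rightarrow>\<^sup>*\<^bsub>G\<^esub> u"
    using assms by (auto simp: strongly_connected_def)
  then obtain w where "awalk x w u"
    by (auto simp: reachable_awalk)
  then show ?thesis
    using walk_lifting[OF bidirected_digraph_axioms p q] assms(5,6)
    unfolding parallel_walks_def by blast
qed

lemma parallel_walks_step:
  assumes "wf_digraph G" "parallel_walks G pe qe x x' u u'"
    "e \<in> arcs G" "tail G e = u" "e' \<in> arcs G" "tail G e' = u'" "pe e = qe e'"
  shows "parallel_walks G pe qe x x' (head G e) (head G e')"
proof -
  interpret wf_digraph G by fact
  obtain w w' where "awalk x w u" "awalk x' w' u'" "map pe w = map qe w'"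
    using assms(2) unfolding parallel_walks_def by blast
  then have "awalk x (w @ [e]) (head G e)" "awalk x' (w' @ [e']) (head G e')"
    "map pe (w @ [e]) = map qe (w' @ [e'])"
    using assms by (auto intro!: awalk_appendI arc_implies_awalk)
  then show ?thesis
    unfolding parallel_walks_def by blast
qed

lemma parallel_walks_verts:
  assumes "wf_digraph G" "parallel_walks G pe qe x x' u u'"
  shows "u \<in> verts G" "u' \<in> verts G"
  using assms wf_digraph.awalk_last_in_verts unfolding parallel_walks_def by metis+

lemma parallel_walks_projection:
  assumes "wf_digraph G"
    and p: "graph_covering G bar H barH pv pe"
    and q: "graph_covering G bar H barH qv qe"
    and "parallel_walks G pe qe x x' u u'" "pv x = qv x'"
  shows "pv u = qv u'"
proof -
  interpret wf_digraph G by fact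
  have "pv u = qv u'" if "awalk x w u" "awalk x' w' u'" "map pe w = map qe w'" "pv x = qv x'" for w w'
    using that
  proof (induction w arbitrary: w' x x')
    case Nil
    then show ?case by (auto simp: awalk_Nil_iff)
  next
    case (Cons e w)
    then obtain e' w'' where w': "w' = e' # w''" by (cases w') auto
    have "pv (head G e) = qv (head G e')"
      using Cons.prems graph_covering_simps(4)[OF p, of e] graph_covering_simps(4)[OF q, of e']
      by (auto simp: w' awalk_Cons_iff)
    then show ?case
      using Cons.IH[of "head G e" "head G e'" w''] Cons.prems by (auto simp: w' awalk_Cons_iff)
  qed
  then show ?thesis
    using assms(4,5) unfolding parallel_walks_def by blast
qed

text \<open>
  The lifting principle for graphs. The vertex map is given by parallel walks; as that relation is
  symmetric in the two coverings, uniqueness and totality also give injectivity and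
  surjectivity. The edge map is then forced, because \<open>q\<close> is bijective on stars.
\<close>

lemma tree_covering_lift:
  assumes tree: "bidirected_tree G bar"
    and p: "graph_covering G bar H barH pv pe"
    and q: "graph_covering G bar H barH qv qe"
    and x: "x \<in> verts G" "x' \<in> verts G" "pv x = qv x'"
  obtains hv he where "graph_automorphism G bar hv he" "hv x = x'"
    "\<And>v. v \<in> verts G \<Longrightarrow> qv (hv v) = pv v" "\<And>e. e \<in> arcs G \<Longrightarrow> qe (he e) = pe e"
proof -
  interpret bidirected_digraph G bar
    using tree by (simp add: bidirected_tree_def)
  let ?R = "parallel_walks G pe qe x x'"
  define hv where "hv u = (THE u'. ?R u u')" for u
  have R: "?R u u' \<longleftrightarrow> u' = hv u" if "u \<in> verts G" for u u'
  proof -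
    obtain u'' where u'': "?R u u''"
      using parallel_walks_total[OF tree p q x \<open>u \<in> verts G\<close>] by blast
    then have "hv u = u''"
      unfolding hv_def using parallel_walks_unique[OF tree p q] by blast
    then show ?thesis
      using u'' parallel_walks_unique[OF tree p q] by blast
  qed
  have hv_verts: "hv u \<in> verts G" if "u \<in> verts G" for u
    using parallel_walks_verts(2)[OF wf_digraph_axioms] R[OF that] by blast
  have hv_proj: "qv (hv u) = pv u" if "u \<in> verts G" for u
    using parallel_walks_projection[OF wf_digraph_axioms p q _ x(3)] R[OF that] by metis
  have hv_inj: "inj_on hv (verts G)"
  proof (rule inj_onI)
    fix u v assume uv: "u \<in> verts G" "v \<in> verts G" "hv u = hv v"
    then have "parallel_walks G qe pe x' x (hv u) u" "parallel_walks G qe pe x' x (hv u) v"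
      using R parallel_walks_commute[of G pe qe x x'] by metis+
    then show "u = v"
      by (rule parallel_walks_unique[OF tree q p])
  qed
  have hv_surj: "\<exists>u \<in> verts G. hv u = u'" if "u' \<in> verts G" for u'
  proof -
    obtain u where "parallel_walks G qe pe x' x u' u"
      using parallel_walks_total[OF tree q p x(2,1) x(3)[symmetric] \<open>u' \<in> verts G\<close>] by blast
    then have "?R u u'"
      using parallel_walks_commute[of G pe qe x x'] by metis
    then show ?thesis
      using R parallel_walks_verts(1)[OF wf_digraph_axioms] by metis
  qed
  define he where "he e = (THE e'. e' \<in> arcs G \<and> tail G e' = hv (tail G e) \<and> qe e' = pe e)" for e
  have he: "e' = he e \<longleftrightarrow> e' \<in> arcs G \<and> tail G e' = hv (tail G e) \<and> qe e' = pe e"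
    if e: "e \<in> arcs G" for e e'
  proof -
    have "tail H (pe e) = qv (hv (tail G e))"
      using e by (simp add: graph_covering_simps(3)[OF p] hv_proj)
    then obtain d where d: "d \<in> arcs G" "tail G d = hv (tail G e)" "qe d = pe e"
      using graph_covering_star_surj[OF q, of "hv (tail G e)" "pe e"] e
        hv_verts graph_covering_simps(2)[OF p e] tail_in_verts by metis
    have "\<exists>!e'. e' \<in> arcs G \<and> tail G e' = hv (tail G e) \<and> qe e' = pe e"
      using d graph_covering_star_inj[OF q wf_digraph_axioms] by (intro ex1I[of _ d]) auto
    from theI'[OF this] this show ?thesis
      unfolding he_def by blast
  qed
  have he_simps: "he e \<in> arcs G" "tail G (he e) = hv (tail G e)" "qe (he e) = pe e"
    if "e \<in> arcs G" for e
    using he[OF that, of "he e"] by auto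
  have he_head: "head G (he e) = hv (head G e)" if e: "e \<in> arcs G" for e
    using parallel_walks_step[OF wf_digraph_axioms _ e refl _ _ , of pe qe x x' "hv (tail G e)" "he e"]
      R he_simps[OF e] e by simp
  have he_bar: "he (bar e) = bar (he e)" if e: "e \<in> arcs G" for e
  proof -
    have "qe (bar (he e)) = pe (bar e)"
      using e he_simps[OF e] graph_covering_simps(5)[OF p, of e]
        graph_covering_simps(5)[OF q, of "he e"] by simp
    then show ?thesis
      using he[of "bar e" "bar (he e)"] e he_simps[OF e] he_head[OF e] by simp
  qed
  have "inj_on he (arcs G)"
  proof (rule inj_onI)
    fix d e assume de: "d \<in> arcs G" "e \<in> arcs G" "he d = he e"
    then have "hv (tail G d) = hv (tail G e)" "pe d = pe e"
      using he_simps by metis+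
    then show "d = e"
      using de hv_inj graph_covering_star_inj[OF p wf_digraph_axioms] by (auto dest: inj_onD)
  qed
  moreover have "\<exists>e \<in> arcs G. he e = e'" if e': "e' \<in> arcs G" for e'
  proof -
    obtain u where u: "u \<in> verts G" "hv u = tail G e'"
      using hv_surj e' by (meson tail_in_verts)
    then have "tail H (qe e') = pv u"
      using e' graph_covering_simps(3)[OF q] hv_proj by metis
    then obtain e where "e \<in> arcs G" "tail G e = u" "pe e = qe e'"
      using graph_covering_star_surj[OF p u(1) graph_covering_simps(2)[OF q e']] by metis
    then show ?thesis
      using he[of e e'] u e' by auto
  qed
  ultimately have "bij_betw he (arcs G) (arcs G)"
    using he_simps(1) by (force simp: bij_betw_def)
  moreover have "bij_betw hv (verts G) (verts G)"
    using hv_inj hv_surj hv_verts by (force simp: bij_betw_def)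
  ultimately have "graph_automorphism G bar hv he"
    unfolding graph_automorphism_def graph_morphism_def
    using hv_verts he_simps he_head he_bar by auto
  moreover have "hv x = x'"
  proof -
    have "?R x x'"
      unfolding parallel_walks_def using x
      by (intro exI[of _ "[]"]) (simp add: awalk_Nil_iff)
    then show ?thesis using R x by simp
  qed
  ultimately show ?thesis
    using that hv_proj he_simps(3) by blast
qed


section \<open>Graphs of objects, their morphisms and coverings\<close>

context category_triple
begin

lemma M1_hom: "f \<in> homset C M1 a b \<Longrightarrow> f \<in> homset C (mors C) a b"
  using groupoid_M1 by (auto simp: homset_def wide_subgroupoid_def wide_subcategory_def)

lemma M2_hom: "f \<in> homset C M2 a b \<Longrightarrow> f \<in> homset C (mors C) a b"
  using subcategory_M2 by (auto simp: homset_def wide_subcategory_def)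

lemma M1_ident: "a \<in> objs C \<Longrightarrow> ident C a \<in> homset C M1 a a"
  using groupoid_M1 ident_in_hom
  by (auto simp: homset_def wide_subgroupoid_def wide_subcategory_def)

lemma M1_cmp:
  assumes "f \<in> homset C M1 a b" "g \<in> homset C M1 b c"
  shows "cmp C g f \<in> homset C M1 a c"
  using groupoid_M1 cmp_in_hom[OF assms[THEN M1_hom]] assms
  by (auto simp: homset_def wide_subgroupoid_def wide_subcategory_def)

lemma cmp_ident:
  assumes "f \<in> homset C (mors C) a b"
  shows "cmp C f (ident C a) = f" "cmp C (ident C b) f = f"
  using assms cmp_ident_left cmp_ident_right by (auto simp: homset_def)

definition minv :: "'m \<Rightarrow> 'm" where
  "minv f = (SOME g. g \<in> homset C M1 (tgt C f) (src C f) \<and>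
     cmp C g f = ident C (src C f) \<and> cmp C f g = ident C (tgt C f))"

lemma minv:
  assumes "f \<in> homset C M1 a b"
  shows "minv f \<in> homset C M1 b a" "cmp C (minv f) f = ident C a" "cmp C f (minv f) = ident C b"
proof -
  have "\<exists>g. g \<in> homset C M1 (tgt C f) (src C f) \<and>
     cmp C g f = ident C (src C f) \<and> cmp C f g = ident C (tgt C f)"
    using assms groupoid_M1 unfolding wide_subgroupoid_def homset_def by blast
  from someI_ex[OF this, folded minv_def]
  show "minv f \<in> homset C M1 b a" "cmp C (minv f) f = ident C a" "cmp C f (minv f) = ident C b"
    using assms by (auto simp: homset_def)
qed

lemma cmp_minv_cancel_left:
  assumes "f \<in> homset C (mors C) a b" "g \<in> homset C M1 b c"
  shows "cmp C (minv g) (cmp C g f) = f"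
  using cmp_assoc[OF assms(1) M1_hom[OF assms(2)] M1_hom[OF minv(1)[OF assms(2)]]]
    minv(2)[OF assms(2)] cmp_ident[OF assms(1)] by simp

lemma cmp_minv_cancel_left':
  assumes "f \<in> homset C (mors C) a c" "g \<in> homset C M1 b c"
  shows "cmp C g (cmp C (minv g) f) = f"
  using cmp_assoc[OF assms(1) M1_hom[OF minv(1)[OF assms(2)]] M1_hom[OF assms(2)]]
    minv(3)[OF assms(2)] cmp_ident[OF assms(1)] by simp

lemma cmp_minv_cancel_right:
  assumes "f \<in> homset C M1 a b" "g \<in> homset C (mors C) b c"
  shows "cmp C (cmp C g f) (minv f) = g"
  using cmp_assoc[OF M1_hom[OF minv(1)[OF assms(1)]] M1_hom[OF assms(1)] assms(2)]
    minv(3)[OF assms(1)] cmp_ident[OF assms(2)] by simp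

lemma M1_cancel_left:
  assumes "f \<in> homset C (mors C) a b" "f' \<in> homset C (mors C) a b"
    "g \<in> homset C M1 b c" "cmp C g f = cmp C g f'"
  shows "f = f'"
  using assms cmp_minv_cancel_left by metis

lemma M1_cancel_right:
  assumes "f \<in> homset C M1 a b" "g \<in> homset C (mors C) b c" "g' \<in> homset C (mors C) b c"
    "cmp C g f = cmp C g' f"
  shows "g = g'"
  using assms cmp_minv_cancel_right by metis

text \<open>
  All compatibility conditions on morphisms of graphs of objects are squares whose vertical sides
  lie in the groupoid. Pasting such squares and inverting them is all the diagram chasing that is
  needed.
\<close>

lemma square_paste:
  assumes "\<phi> \<in> homset C (mors C) s a" "\<psi> \<in> homset C (mors C) s' a'" "\<chi> \<in> homset C (mors C) s'' a''"
    and "f \<in> homset C M1 a a'" "f' \<in> homset C M1 a' a''"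
    and "g \<in> homset C M1 s s'" "g' \<in> homset C M1 s' s''"
    and "cmp C f \<phi> = cmp C \<psi> g" "cmp C f' \<psi> = cmp C \<chi> g'"
  shows "cmp C (cmp C f' f) \<phi> = cmp C \<chi> (cmp C g' g)"
proof -
  note M = M1_hom[OF assms(4)] M1_hom[OF assms(5)] M1_hom[OF assms(6)] M1_hom[OF assms(7)]
  have "cmp C (cmp C f' f) \<phi> = cmp C f' (cmp C \<psi> g)"
    using cmp_assoc[OF assms(1) M(1,2)] assms(8) by simp
  also have "\<dots> = cmp C (cmp C \<chi> g') g"
    using cmp_assoc[OF M(3) assms(2) M(2)] assms(9) by simp
  also have "\<dots> = cmp C \<chi> (cmp C g' g)"
    using cmp_assoc[OF M(3,4) assms(3)] by simp
  finally show ?thesis .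
qed

lemma square_inverse:
  assumes "\<phi> \<in> homset C (mors C) s a" "\<psi> \<in> homset C (mors C) s' a'"
    and "f \<in> homset C M1 a a'" "g \<in> homset C M1 s s'"
    and "cmp C f \<phi> = cmp C \<psi> g"
  shows "cmp C (minv f) \<psi> = cmp C \<phi> (minv g)"
proof -
  note F = minv(1)[OF assms(3)] and G = minv(1)[OF assms(4)]
  have "\<psi> = cmp C f (cmp C \<phi> (minv g))"
    using cmp_minv_cancel_right[OF assms(4,2)] assms(5)
      cmp_assoc[OF M1_hom[OF G] assms(1) M1_hom[OF assms(3)]] by simp
  then show ?thesis
    using cmp_minv_cancel_left[OF cmp_in_hom[OF M1_hom[OF G] assms(1)] assms(3)] by simp
qed

lemma goo_simps:
  assumes "is_graph_of_objs C M2 X"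
  shows "bidirected_digraph (grph X) (einv X)"
    and "v \<in> verts (grph X) \<Longrightarrow> vobj X v \<in> objs C"
    and "e \<in> arcs (grph X) \<Longrightarrow> eobj X e \<in> objs C"
    and "e \<in> arcs (grph X) \<Longrightarrow> eobj X (einv X e) = eobj X e"
    and "e \<in> arcs (grph X) \<Longrightarrow>
      phi0 X e \<in> homset C M2 (eobj X e) (vobj X (tail (grph X) e))"
    and "e \<in> arcs (grph X) \<Longrightarrow> phi1 X e = phi0 X (einv X e)"
  using assms unfolding is_graph_of_objs_def by blast+

lemma goo_phi0_hom:
  assumes "is_graph_of_objs C M2 X" "e \<in> arcs (grph X)"
  shows "phi0 X e \<in> homset C (mors C) (eobj X e) (vobj X (tail (grph X) e))"
  using goo_simps(5)[OF assms] by (rule M2_hom)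

lemma goo_arcs:
  assumes "is_graph_of_objs C M2 X" "e \<in> arcs (grph X)"
  shows "tail (grph X) e \<in> verts (grph X)" "head (grph X) e \<in> verts (grph X)"
    "einv X e \<in> arcs (grph X)" "einv X (einv X e) = e"
    "tail (grph X) (einv X e) = head (grph X) e" "head (grph X) (einv X e) = tail (grph X) e"
proof -
  interpret bidirected_digraph "grph X" "einv X" by (rule goo_simps(1)[OF assms(1)])
  show "tail (grph X) e \<in> verts (grph X)" "head (grph X) e \<in> verts (grph X)"
    "einv X e \<in> arcs (grph X)" "einv X (einv X e) = e"
    "tail (grph X) (einv X e) = head (grph X) e" "head (grph X) (einv X e) = tail (grph X) e"
    using assms(2) by auto
qed

lemma is_graph_of_objsI:
  assumes bidir: "bidirected_digraph (grph X) (einv X)"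
    and "\<And>v. v \<in> verts (grph X) \<Longrightarrow> vobj X v \<in> objs C"
    and "\<And>e. e \<in> arcs (grph X) \<Longrightarrow> eobj X e \<in> objs C"
    and eobj: "\<And>e. e \<in> arcs (grph X) \<Longrightarrow> eobj X (einv X e) = eobj X e"
    and phi0: "\<And>e. e \<in> arcs (grph X) \<Longrightarrow>
      phi0 X e \<in> homset C M2 (eobj X e) (vobj X (tail (grph X) e))"
    and phi1: "\<And>e. e \<in> arcs (grph X) \<Longrightarrow> phi1 X e = phi0 X (einv X e)"
  shows "is_graph_of_objs C M2 X"
proof -
  interpret bidirected_digraph "grph X" "einv X" by (rule bidir)
  have "phi1 X e \<in> homset C M2 (eobj X e) (vobj X (head (grph X) e))"
    "phi0 X e = phi1 X (einv X e)" if e: "e \<in> arcs (grph X)" for e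
    using phi0[OF arev_in_arcs[OF e]] phi1[OF e] phi1[OF arev_in_arcs[OF e]] eobj[OF e] e by simp_all
  then show ?thesis
    unfolding is_graph_of_objs_def using assms by blast
qed

text \<open>
  The conditions at the terminal vertex of an edge are those at the initial vertex of its
  inverse, so it suffices to check one end.
\<close>

lemma goo_morphismI:
  assumes X: "is_graph_of_objs C M2 X" and Y: "is_graph_of_objs C M2 Y"
    and v: "\<And>v. v \<in> verts (grph X) \<Longrightarrow> vmap f v \<in> verts (grph Y)"
    and vm: "\<And>v. v \<in> verts (grph X) \<Longrightarrow> vmor f v \<in> homset C M1 (vobj X v) (vobj Y (vmap f v))"
    and e: "\<And>e. e \<in> arcs (grph X) \<Longrightarrow> emap f e \<in> arcs (grph Y)"
    and t: "\<And>e. e \<in> arcs (grph X) \<Longrightarrow> tail (grph Y) (emap f e) = vmap f (tail (grph X) e)"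
    and i: "\<And>e. e \<in> arcs (grph X) \<Longrightarrow> emap f (einv X e) = einv Y (emap f e)"
    and em: "\<And>e. e \<in> arcs (grph X) \<Longrightarrow> emor f e \<in> homset C M1 (eobj X e) (eobj Y (emap f e))"
    and ei: "\<And>e. e \<in> arcs (grph X) \<Longrightarrow> emor f (einv X e) = emor f e"
    and sq: "\<And>e. e \<in> arcs (grph X) \<Longrightarrow>
      cmp C (vmor f (tail (grph X) e)) (phi0 X e) = cmp C (phi0 Y (emap f e)) (emor f e)"
  shows "goo_morphism C M1 X Y f"
proof -
  have h: "head (grph Y) (emap f e) = vmap f (head (grph X) e)" if "e \<in> arcs (grph X)" for e
    using goo_arcs[OF X that] goo_arcs[OF Y e[OF that]] t i[OF that] by metis
  moreover have "cmp C (vmor f (head (grph X) e)) (phi1 X e) = cmp C (phi1 Y (emap f e)) (emor f e)"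
    if "e \<in> arcs (grph X)" for e
    using goo_arcs[OF X that] sq[of "einv X e"] i[OF that] ei[OF that]
      goo_simps(6)[OF X that] goo_simps(6)[OF Y e[OF that]] by simp
  ultimately show ?thesis
    unfolding goo_morphism_def graph_morphism_def using v vm e t i em ei sq by auto
qed

lemma goo_morphism_simps:
  assumes "goo_morphism C M1 X Y f"
  shows "v \<in> verts (grph X) \<Longrightarrow> vmap f v \<in> verts (grph Y)"
    and "v \<in> verts (grph X) \<Longrightarrow> vmor f v \<in> homset C M1 (vobj X v) (vobj Y (vmap f v))"
    and "e \<in> arcs (grph X) \<Longrightarrow> emap f e \<in> arcs (grph Y)"
    and "e \<in> arcs (grph X) \<Longrightarrow> tail (grph Y) (emap f e) = vmap f (tail (grph X) e)"
    and "e \<in> arcs (grph X) \<Longrightarrow> emap f (einv X e) = einv Y (emap f e)"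
    and "e \<in> arcs (grph X) \<Longrightarrow> emor f e \<in> homset C M1 (eobj X e) (eobj Y (emap f e))"
    and "e \<in> arcs (grph X) \<Longrightarrow> emor f (einv X e) = emor f e"
    and "e \<in> arcs (grph X) \<Longrightarrow>
      cmp C (vmor f (tail (grph X) e)) (phi0 X e) = cmp C (phi0 Y (emap f e)) (emor f e)"
  using assms by (auto simp: goo_morphism_def graph_morphism_def)

lemma goo_coveringI:
  assumes mor: "goo_morphism C M1 X Y f"
    and "\<And>v. v \<in> verts (grph Y) \<Longrightarrow> v \<in> vmap f ` verts (grph X)"
    and "\<And>e. e \<in> arcs (grph Y) \<Longrightarrow> e \<in> emap f ` arcs (grph X)"
    and inj: "\<And>d e. d \<in> arcs (grph X) \<Longrightarrow> e \<in> arcs (grph X) \<Longrightarrow>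
      tail (grph X) d = tail (grph X) e \<Longrightarrow> emap f d = emap f e \<Longrightarrow> d = e"
    and surj: "\<And>v d. v \<in> verts (grph X) \<Longrightarrow> d \<in> arcs (grph Y) \<Longrightarrow> tail (grph Y) d = vmap f v \<Longrightarrow>
      \<exists>e \<in> arcs (grph X). tail (grph X) e = v \<and> emap f e = d"
  shows "goo_covering C M1 X Y f"
proof -
  have "bij_betw (emap f) (out_arcs (grph X) v) (out_arcs (grph Y) (vmap f v))"
    if v: "v \<in> verts (grph X)" for v
  proof -
    have "inj_on (emap f) (out_arcs (grph X) v)"
      using inj by (auto simp: inj_on_def)
    moreover have "emap f ` out_arcs (grph X) v \<subseteq> out_arcs (grph Y) (vmap f v)"
      using goo_morphism_simps[OF mor] by auto
    moreover have "out_arcs (grph Y) (vmap f v) \<subseteq> emap f ` out_arcs (grph X) v"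
      using surj[OF v] by (fastforce simp: image_iff)
    ultimately show ?thesis
      by (auto simp: bij_betw_def)
  qed
  moreover have "vmap f ` verts (grph X) = verts (grph Y)" "emap f ` arcs (grph X) = arcs (grph Y)"
    using assms(2,3) goo_morphism_simps[OF mor] by auto
  ultimately show ?thesis
    using mor unfolding goo_covering_def graph_covering_def goo_morphism_def by blast
qed

definition goo_comp ::
    "('w, 'd, 'w2, 'd2, 'm) goo_map \<Rightarrow> ('v, 'e, 'w, 'd, 'm) goo_map \<Rightarrow> ('v, 'e, 'w2, 'd2, 'm) goo_map" where
  "goo_comp g f = \<lparr>vmap = vmap g \<circ> vmap f, emap = emap g \<circ> emap f,
     vmor = (\<lambda>v. cmp C (vmor g (vmap f v)) (vmor f v)),
     emor = (\<lambda>e. cmp C (emor g (emap f e)) (emor f e))\<rparr>"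

lemma goo_comp_simps [simp]:
  "vmap (goo_comp g f) v = vmap g (vmap f v)"
  "emap (goo_comp g f) e = emap g (emap f e)"
  "vmor (goo_comp g f) v = cmp C (vmor g (vmap f v)) (vmor f v)"
  "emor (goo_comp g f) e = cmp C (emor g (emap f e)) (emor f e)"
  by (simp_all add: goo_comp_def)

lemma goo_morphism_comp:
  assumes X: "is_graph_of_objs C M2 X" and Y: "is_graph_of_objs C M2 Y" and Z: "is_graph_of_objs C M2 Z"
    and f: "goo_morphism C M1 X Y f" and g: "goo_morphism C M1 Y Z g"
  shows "goo_morphism C M1 X Z (goo_comp g f)"
proof (rule goo_morphismI[OF X Z])
  fix e assume e: "e \<in> arcs (grph X)"
  note f_e = goo_morphism_simps[OF f] goo_arcs[OF X e]
  show "cmp C (vmor (goo_comp g f) (tail (grph X) e)) (phi0 X e) =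
    cmp C (phi0 Z (emap (goo_comp g f) e)) (emor (goo_comp g f) e)"
    unfolding goo_comp_simps
    using square_paste[OF goo_phi0_hom[OF X e] goo_phi0_hom[OF Y] goo_phi0_hom[OF Z]]
      e f_e goo_morphism_simps[OF g] by metis
next
  fix v assume "v \<in> verts (grph X)"
  then show "vmor (goo_comp g f) v \<in> homset C M1 (vobj X v) (vobj Z (vmap (goo_comp g f) v))"
    unfolding goo_comp_simps
    by (intro M1_cmp[OF goo_morphism_simps(2)[OF f] goo_morphism_simps(2)[OF g]] goo_morphism_simps(1)[OF f])
next
  fix e assume "e \<in> arcs (grph X)"
  then show "emor (goo_comp g f) e \<in> homset C M1 (eobj X e) (eobj Z (emap (goo_comp g f) e))"
    unfolding goo_comp_simps
    by (intro M1_cmp[OF goo_morphism_simps(6)[OF f] goo_morphism_simps(6)[OF g]] goo_morphism_simps(3)[OF f])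
qed (simp_all add: goo_morphism_simps[OF f] goo_morphism_simps[OF g] goo_arcs[OF X])

lemma goo_covering_simps:
  assumes "goo_covering C M1 X Y f"
  shows "goo_morphism C M1 X Y f"
    and "v \<in> verts (grph Y) \<Longrightarrow> \<exists>u \<in> verts (grph X). vmap f u = v"
    and "e \<in> arcs (grph Y) \<Longrightarrow> \<exists>d \<in> arcs (grph X). emap f d = e"
  using assms unfolding goo_covering_def graph_covering_def by (blast, metis imageE, metis imageE)

lemma goo_covering_star_inj:
  assumes "goo_covering C M1 X Y f" "is_graph_of_objs C M2 X" "d \<in> arcs (grph X)" "e \<in> arcs (grph X)"
    "tail (grph X) d = tail (grph X) e" "emap f d = emap f e"
  shows "d = e"
  using assms graph_covering_star_inj bidirected_digraph.axioms(1)[OF goo_simps(1)[OF assms(2)]]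
  unfolding goo_covering_def by metis

lemma goo_covering_star_surj:
  assumes "goo_covering C M1 X Y f" "v \<in> verts (grph X)" "d \<in> arcs (grph Y)" "tail (grph Y) d = vmap f v"
  shows "\<exists>e \<in> arcs (grph X). tail (grph X) e = v \<and> emap f e = d"
  using assms graph_covering_star_surj unfolding goo_covering_def by metis

lemma goo_covering_comp:
  assumes X: "is_graph_of_objs C M2 X" and Y: "is_graph_of_objs C M2 Y" and Z: "is_graph_of_objs C M2 Z"
    and f: "goo_covering C M1 X Y f" and g: "goo_covering C M1 Y Z g"
  shows "goo_covering C M1 X Z (goo_comp g f)"
proof (rule goo_coveringI)
  note f' = goo_morphism_simps[OF goo_covering_simps(1)[OF f]]
  note g' = goo_morphism_simps[OF goo_covering_simps(1)[OF g]]
  show "goo_morphism C M1 X Z (goo_comp g f)"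
    by (rule goo_morphism_comp[OF X Y Z goo_covering_simps(1)[OF f] goo_covering_simps(1)[OF g]])
  show "v \<in> vmap (goo_comp g f) ` verts (grph X)" if "v \<in> verts (grph Z)" for v
    using goo_covering_simps(2)[OF f] goo_covering_simps(2)[OF g that] by (force simp: image_iff)
  show "e \<in> emap (goo_comp g f) ` arcs (grph X)" if "e \<in> arcs (grph Z)" for e
    using goo_covering_simps(3)[OF f] goo_covering_simps(3)[OF g that] by (force simp: image_iff)
  show "d = e" if "d \<in> arcs (grph X)" "e \<in> arcs (grph X)" "tail (grph X) d = tail (grph X) e"
    "emap (goo_comp g f) d = emap (goo_comp g f) e" for d e
    using that goo_covering_star_inj[OF f X] goo_covering_star_inj[OF g Y] f' by simp
  show "\<exists>e \<in> arcs (grph X). tail (grph X) e = v \<and> emap (goo_comp g f) e = d"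
    if d: "v \<in> verts (grph X)" "d \<in> arcs (grph Z)" "tail (grph Z) d = vmap (goo_comp g f) v" for v d
  proof -
    obtain d' where d': "d' \<in> arcs (grph Y)" "tail (grph Y) d' = vmap f v" "emap g d' = d"
      using goo_covering_star_surj[OF g f'(1)[OF d(1)] d(2)] d(3) by auto
    then show ?thesis
      using goo_covering_star_surj[OF f d(1) d'(1,2)] by auto
  qed
qed

lemma goo_covering_if_bij:
  assumes X: "is_graph_of_objs C M2 X" and f: "goo_morphism C M1 X Y f"
    and v: "bij_betw (vmap f) (verts (grph X)) (verts (grph Y))"
    and e: "bij_betw (emap f) (arcs (grph X)) (arcs (grph Y))"
  shows "goo_covering C M1 X Y f"
proof (rule goo_coveringI[OF f])
  show "\<exists>e \<in> arcs (grph X). tail (grph X) e = u \<and> emap f e = d"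
    if d: "u \<in> verts (grph X)" "d \<in> arcs (grph Y)" "tail (grph Y) d = vmap f u" for u d
  proof -
    obtain e' where e': "e' \<in> arcs (grph X)" "emap f e' = d"
      using e d(2) by (metis bij_betw_imp_surj_on imageE)
    then have "vmap f (tail (grph X) e') = vmap f u"
      using d goo_morphism_simps(4)[OF f] by auto
    then have "tail (grph X) e' = u"
      using v d(1) goo_arcs(1)[OF X e'(1)] by (auto simp: bij_betw_def dest: inj_onD)
    then show ?thesis using e' by blast
  qed
qed (use v e in \<open>auto simp: bij_betw_def dest: inj_onD\<close>)

text \<open>
  The lifting principle for graphs of objects: over the graph automorphism provided by
  \<open>tree_covering_lift\<close>, the morphisms are \<open>q\<inverse> \<circ> p\<close>, computed in the groupoid.
\<close>

lemma goo_covering_lift: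
  assumes X: "is_tree_of_objs C M2 X" and Y: "is_graph_of_objs C M2 Y"
    and p: "goo_covering C M1 X Y p" and q: "goo_covering C M1 X Y q"
    and x: "x \<in> verts (grph X)" "x' \<in> verts (grph X)" "vmap p x = vmap q x'"
  obtains g where "g \<in> goo_Aut C M1 X" "vmap g x = x'"
    "\<And>v. v \<in> verts (grph X) \<Longrightarrow> vmap q (vmap g v) = vmap p v"
    "\<And>e. e \<in> arcs (grph X) \<Longrightarrow> emap q (emap g e) = emap p e"
    "\<And>e. e \<in> arcs (grph X) \<Longrightarrow> cmp C (emor q (emap g e)) (emor g e) = emor p e"
proof -
  note XX = X[unfolded is_tree_of_objs_def, THEN conjunct1]
  note p' = goo_morphism_simps[OF goo_covering_simps(1)[OF p]]
  note q' = goo_morphism_simps[OF goo_covering_simps(1)[OF q]]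
  obtain hv he where h: "graph_automorphism (grph X) (einv X) hv he" "hv x = x'"
    and hv: "\<And>v. v \<in> verts (grph X) \<Longrightarrow> vmap q (hv v) = vmap p v"
    and he: "\<And>e. e \<in> arcs (grph X) \<Longrightarrow> emap q (he e) = emap p e"
    using tree_covering_lift[OF X[unfolded is_tree_of_objs_def, THEN conjunct2]
        p[unfolded goo_covering_def, THEN conjunct2] q[unfolded goo_covering_def, THEN conjunct2] x]
    by blast
  define g where "g = \<lparr>vmap = hv, emap = he,
    vmor = (\<lambda>v. cmp C (minv (vmor q (hv v))) (vmor p v)),
    emor = (\<lambda>e. cmp C (minv (emor q (he e))) (emor p e))\<rparr>"
  have h_simps:
    "v \<in> verts (grph X) \<Longrightarrow> hv v \<in> verts (grph X)"
    "e \<in> arcs (grph X) \<Longrightarrow> he e \<in> arcs (grph X)"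
    "e \<in> arcs (grph X) \<Longrightarrow> tail (grph X) (he e) = hv (tail (grph X) e)"
    "e \<in> arcs (grph X) \<Longrightarrow> he (einv X e) = einv X (he e)" for v e
    using h by (auto simp: graph_automorphism_def graph_morphism_def)
  have "goo_morphism C M1 X X g"
  proof (rule goo_morphismI[OF XX XX])
    fix v assume v: "v \<in> verts (grph X)"
    show "vmor g v \<in> homset C M1 (vobj X v) (vobj X (vmap g v))"
      using M1_cmp[OF p'(2)[OF v]] minv(1)[OF q'(2)[OF h_simps(1)[OF v]]] hv[OF v]
      by (simp add: g_def)
  next
    fix e assume e: "e \<in> arcs (grph X)"
    note t = goo_arcs(1)[OF XX e]
    note he_e = h_simps(2)[OF e]
    note pe = p'(6)[OF e] and qe = q'(6)[OF he_e]
    note pv = p'(2)[OF t] and qv = q'(2)[OF h_simps(1)[OF t]]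
    show "emor g e \<in> homset C M1 (eobj X e) (eobj X (emap g e))"
      using M1_cmp[OF pe] minv(1)[OF qe] he[OF e] by (simp add: g_def)
    show "emor g (einv X e) = emor g e"
      using p'(7)[OF e] q'(7)[OF he_e] by (simp add: g_def h_simps(4)[OF e])
    have "cmp C (minv (vmor q (hv (tail (grph X) e)))) (phi0 Y (emap p e)) =
      cmp C (phi0 X (he e)) (minv (emor q (he e)))"
      using square_inverse[OF goo_phi0_hom[OF XX he_e] goo_phi0_hom[OF Y q'(3)[OF he_e]] _ qe q'(8)[OF he_e]]
        qv he[OF e] q'(4)[OF he_e] h_simps(3)[OF e] by simp
    then show "cmp C (vmor g (tail (grph X) e)) (phi0 X e) = cmp C (phi0 X (emap g e)) (emor g e)"
      using square_paste[OF goo_phi0_hom[OF XX e] goo_phi0_hom[OF Y p'(3)[OF e]] goo_phi0_hom[OF XX he_e]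
         _ _ pe _ p'(8)[OF e]] pv minv(1)[OF qv] minv(1)[OF qe] he[OF e] hv[OF t] p'(4)[OF e]
        h_simps(3)[OF e] by (simp add: g_def)
  qed (auto simp: g_def h_simps)
  then have "g \<in> goo_Aut C M1 X"
    using h by (simp add: goo_Aut_def g_def)
  moreover have "cmp C (emor q (emap g e)) (emor g e) = emor p e" if e: "e \<in> arcs (grph X)" for e
    using cmp_minv_cancel_left'[OF M1_hom[OF p'(6)[OF e]]] q'(6)[OF h_simps(2)[OF e]] he[OF e]
    by (simp add: g_def)
  ultimately show ?thesis
    using that[of g] h hv he by (simp add: g_def)
qed

text \<open>
  The gluing construction produces vertices and edges of a type that depends on the given data;
  numbering them turns the result into a graph of objects on the natural numbers.
\<close>

lemma finite_goo_copy_on_nat: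
  fixes Z :: "('v, 'e, 'o, 'm) graph_of_objs"
  assumes "is_finite_graph_of_objs C M2 Z"
  shows "\<exists>(Z' :: (nat, nat, 'o, 'm) graph_of_objs) f.
    is_finite_graph_of_objs C M2 Z' \<and> goo_covering C M1 Z' Z f"
proof -
  have Z: "is_graph_of_objs C M2 Z" and fin: "fin_digraph (grph Z)"
    using assms by (auto simp: is_finite_graph_of_objs_def)
  have "finite (verts (grph Z))" "finite (arcs (grph Z))"
    using fin by (auto simp: fin_digraph_def fin_digraph_axioms_def)
  then obtain a b where a: "bij_betw a {0..<card (verts (grph Z))} (verts (grph Z))"
    and b: "bij_betw b {0..<card (arcs (grph Z))} (arcs (grph Z))"
    using ex_bij_betw_nat_finite by metis
  let ?V = "{0..<card (verts (grph Z))}" and ?E = "{0..<card (arcs (grph Z))}"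
  define a' where "a' = inv_into ?V a"
  define b' where "b' = inv_into ?E b"
  have a_simps: "i \<in> ?V \<Longrightarrow> a i \<in> verts (grph Z)" "v \<in> verts (grph Z) \<Longrightarrow> a' v \<in> ?V"
    "v \<in> verts (grph Z) \<Longrightarrow> a (a' v) = v" for i v
    using a unfolding a'_def
    by (auto simp: bij_betw_def inv_into_into f_inv_into_f simp del: atLeastLessThan_iff)
  have b_simps: "i \<in> ?E \<Longrightarrow> b i \<in> arcs (grph Z)" "e \<in> arcs (grph Z) \<Longrightarrow> b' e \<in> ?E"
    "i \<in> ?E \<Longrightarrow> b' (b i) = i" "e \<in> arcs (grph Z) \<Longrightarrow> b (b' e) = e" for i e
    using b unfolding b'_def
    by (auto simp: bij_betw_def inv_into_into f_inv_into_f simp del: atLeastLessThan_iff)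
  define Z' :: "(nat, nat, 'o, 'm) graph_of_objs" where
    "Z' = \<lparr>grph = \<lparr>verts = ?V, arcs = ?E, tail = (\<lambda>i. a' (tail (grph Z) (b i))),
        head = (\<lambda>i. a' (head (grph Z) (b i)))\<rparr>,
      einv = (\<lambda>i. if i \<in> ?E then b' (einv Z (b i)) else i),
      vobj = vobj Z \<circ> a, eobj = eobj Z \<circ> b, phi0 = phi0 Z \<circ> b, phi1 = phi1 Z \<circ> b\<rparr>"
  note Z_arcs = goo_arcs[OF Z b_simps(1)]
  note arev = bidirected_digraph.arev_neq[OF goo_simps(1)[OF Z]]
  have "fin_digraph (grph Z')"
    by unfold_locales (simp_all add: Z'_def a_simps Z_arcs del: atLeastLessThan_iff)
  moreover have bidir: "bidirected_digraph (grph Z') (einv Z')"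
  proof (rule wf_digraph.bidirected_digraphI)
    show "wf_digraph (grph Z')"
      by unfold_locales (simp_all add: Z'_def a_simps Z_arcs del: atLeastLessThan_iff)
    show "einv Z' i \<noteq> i" if "i \<in> arcs (grph Z')" for i
      using that arev[OF b_simps(1)[of i]] b_simps(4)[OF Z_arcs(3)[of i]]
      by (auto simp: Z'_def simp del: atLeastLessThan_iff)
  qed (simp_all add: Z'_def a_simps b_simps Z_arcs del: atLeastLessThan_iff)
  moreover have Z': "is_graph_of_objs C M2 Z'"
    by (rule is_graph_of_objsI[OF bidir])
      (use goo_simps[OF Z] in \<open>simp_all add: Z'_def a_simps b_simps Z_arcs del: atLeastLessThan_iff\<close>)
  ultimately have fin': "is_finite_graph_of_objs C M2 Z'"
    by (simp add: is_finite_graph_of_objs_def)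
  define f where "f = \<lparr>vmap = a, emap = b, vmor = (\<lambda>i. ident C (vobj Z' i)),
    emor = (\<lambda>i. ident C (eobj Z' i))\<rparr>"
  have "goo_morphism C M1 Z' Z f"
  proof (rule goo_morphismI[OF Z' Z])
    fix i assume i: "i \<in> arcs (grph Z')"
    then have "i \<in> ?E" by (simp add: Z'_def)
    then show "cmp C (vmor f (tail (grph Z') i)) (phi0 Z' i) = cmp C (phi0 Z (emap f i)) (emor f i)"
      using cmp_ident[OF goo_phi0_hom[OF Z b_simps(1)]]
      by (simp add: f_def Z'_def a_simps Z_arcs del: atLeastLessThan_iff)
  qed (use M1_ident goo_simps[OF Z] in
      \<open>simp_all add: f_def Z'_def a_simps b_simps Z_arcs del: atLeastLessThan_iff\<close>)
  then have "goo_covering C M1 Z' Z f"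
    by (rule goo_covering_if_bij[OF Z']) (use a b in \<open>simp_all add: f_def Z'_def\<close>)
  with fin' show ?thesis by blast
qed

end


section \<open>Germs of coverings and how often they meet\<close>

text \<open>
  Labelling \<open>K\<close> points evenly by \<open>A\<close> is how the weight \<open>1 / card A\<close> is realised by integers.
\<close>

lemma finite_equidistributed_labelling:
  assumes "finite A" "card A dvd K"
  obtains l :: "nat \<Rightarrow> 'a" where "\<And>i. i < K \<Longrightarrow> l i \<in> A"
    "\<And>a. a \<in> A \<Longrightarrow> card {i. i < K \<and> l i = a} = K div card A"
proof -
  have "card {0..<K} = card (A \<times> {0..<K div card A})"
    using assms by (simp add: card_cartesian_product)
  then obtain h where h: "bij_betw h {0..<K} (A \<times> {0..<K div card A})"
    using finite_same_card_bij[of "{0..<K}" "A \<times> {0..<K div card A}"] assms(1) by auto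
  show ?thesis
  proof (rule that[of "fst \<circ> h"])
    fix i assume "i < K"
    then have "h i \<in> A \<times> {0..<K div card A}"
      using bij_betwE[OF h] by simp
    then show "(fst \<circ> h) i \<in> A" by auto
  next
    fix a assume a: "a \<in> A"
    have inj: "inj_on h {i. i < K \<and> (fst \<circ> h) i = a}"
      using h by (auto simp: bij_betw_def inj_on_def)
    have "h ` {i. i < K \<and> (fst \<circ> h) i = a} = {x \<in> h ` {0..<K}. fst x = a}"
      by auto
    also have "\<dots> = {a} \<times> {0..<K div card A}"
      using h a by (auto simp: bij_betw_def)
    finally show "card {i. i < K \<and> (fst \<circ> h) i = a} = K div card A"
      using card_image[OF inj] by (simp add: card_cartesian_product)
  qed
qed

locale two_covered_goos = category_triple C M1 M2
  for C :: "('o, 'm) category" and M1 M2 :: "'m set" +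
  fixes X1 :: "('v1, 'e1, 'o, 'm) graph_of_objs"
    and X2 :: "('v2, 'e2, 'o, 'm) graph_of_objs"
    and X :: "('v, 'e, 'o, 'm) graph_of_objs"
    and p :: "('v, 'e, 'v1, 'e1, 'm) goo_map"
  assumes X1_fin: "is_finite_graph_of_objs C M2 X1"
    and X2_fin: "is_finite_graph_of_objs C M2 X2"
    and X_tree: "is_tree_of_objs C M2 X"
    and p_cov: "goo_covering C M1 X X1 p"
    and X2_covered: "is_cover_of C M1 X X2"
    and isotropy: "finite_edge_isotropy X (goo_Aut C M1 X)"
begin

lemma X1: "is_graph_of_objs C M2 X1" and X2: "is_graph_of_objs C M2 X2"
  and X: "is_graph_of_objs C M2 X"
  using X1_fin X2_fin X_tree by (auto simp: is_finite_graph_of_objs_def is_tree_of_objs_def)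

lemma finite_X1: "finite (verts (grph X1))" "finite (arcs (grph X1))"
  and finite_X2: "finite (verts (grph X2))" "finite (arcs (grph X2))"
  using X1_fin X2_fin
  by (auto simp: is_finite_graph_of_objs_def fin_digraph_def fin_digraph_axioms_def)

definition Cov :: "('v, 'e, 'v2, 'e2, 'm) goo_map set" where
  "Cov = {q. goo_covering C M1 X X2 q}"

lemma Cov_nonempty: "\<exists>q. q \<in> Cov"
  using X2_covered by (auto simp: is_cover_of_def Cov_def)

lemmas p_mor = goo_morphism_simps[OF goo_covering_simps(1)[OF p_cov]]

lemma CovD: "q \<in> Cov \<Longrightarrow> goo_covering C M1 X X2 q"
  by (simp add: Cov_def)

lemma Cov: "q \<in> Cov \<Longrightarrow> goo_morphism C M1 X X2 q"
  using goo_covering_simps(1) CovD by blast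

lemmas Cov_mor = goo_morphism_simps[OF Cov]

lemma Aut_covering:
  assumes "g \<in> goo_Aut C M1 X"
  shows "goo_covering C M1 X X g"
  using assms goo_covering_if_bij[OF X] unfolding goo_Aut_def graph_automorphism_def by blast

lemmas Aut_mor = goo_morphism_simps[OF goo_covering_simps(1)[OF Aut_covering]]

lemma Cov_comp_Aut:
  assumes "q \<in> Cov" "g \<in> goo_Aut C M1 X"
  shows "goo_comp q g \<in> Cov"
  using goo_covering_comp[OF X X X2 Aut_covering[OF assms(2)] CovD[OF assms(1)]]
  by (simp add: Cov_def)

text \<open>
  Reading the morphism between \<open>X1\<close> and \<open>X2\<close>, instead of the morphism out of \<open>X\<close>, makes
  germs comparable at different lifts of the same edge of \<open>X1\<close>.
\<close>

definition edge_germ :: "('v, 'e, 'v2, 'e2, 'm) goo_map \<Rightarrow> 'e \<Rightarrow> 'e1 \<times> 'e2 \<times> 'm" where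
  "edge_germ q e = (emap p e, emap q e, cmp C (emor q e) (minv (emor p e)))"

lemma fst_edge_germ [simp]: "fst (edge_germ q e) = emap p e"
  by (simp add: edge_germ_def)

definition star_germ ::
    "('v, 'e, 'v2, 'e2, 'm) goo_map \<Rightarrow> 'v \<Rightarrow> 'v1 \<times> 'v2 \<times> ('e1 \<times> 'e2 \<times> 'm) set" where
  "star_germ q v = (vmap p v, vmap q v, edge_germ q ` out_arcs (grph X) v)"

definition edge_germs :: "('e1 \<times> 'e2 \<times> 'm) set" where
  "edge_germs = {edge_germ q e | q e. q \<in> Cov \<and> e \<in> arcs (grph X)}"

definition star_germs :: "('v1 \<times> 'v2 \<times> ('e1 \<times> 'e2 \<times> 'm) set) set" where
  "star_germs = {star_germ q v | q v. q \<in> Cov \<and> v \<in> verts (grph X)}"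

definition germ_inv :: "'e1 \<times> 'e2 \<times> 'm \<Rightarrow> 'e1 \<times> 'e2 \<times> 'm" where
  "germ_inv t = (einv X1 (fst t), einv X2 (fst (snd t)), snd (snd t))"

lemma edge_germ_in: "q \<in> Cov \<Longrightarrow> e \<in> arcs (grph X) \<Longrightarrow> edge_germ q e \<in> edge_germs"
  by (auto simp: edge_germs_def)

lemma star_germ_in: "q \<in> Cov \<Longrightarrow> v \<in> verts (grph X) \<Longrightarrow> star_germ q v \<in> star_germs"
  by (auto simp: star_germs_def)

lemma germ_inv_edge_germ:
  "q \<in> Cov \<Longrightarrow> e \<in> arcs (grph X) \<Longrightarrow> germ_inv (edge_germ q e) = edge_germ q (einv X e)"
  by (simp add: germ_inv_def edge_germ_def p_mor Cov_mor)

lemma germ_inv_in: "t \<in> edge_germs \<Longrightarrow> germ_inv t \<in> edge_germs"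
  using germ_inv_edge_germ edge_germ_in goo_arcs(3)[OF X] unfolding edge_germs_def by blast

lemma edge_germs_over:
  assumes "t \<in> edge_germs"
  shows "fst t \<in> arcs (grph X1)" "fst (snd t) \<in> arcs (grph X2)"
    "snd (snd t) \<in> homset C M1 (eobj X1 (fst t)) (eobj X2 (fst (snd t)))"
  using assms p_mor Cov_mor M1_cmp[OF minv(1)[OF p_mor(6)] Cov_mor(6)] by (auto simp: edge_germs_def edge_germ_def)

lemma germ_inv_germ_inv: "t \<in> edge_germs \<Longrightarrow> germ_inv (germ_inv t) = t"
  using goo_arcs(4)[OF X1] goo_arcs(4)[OF X2] edge_germs_over by (simp add: germ_inv_def)

lemma edge_germ_eqD:
  assumes "q \<in> Cov" "q' \<in> Cov" "e \<in> arcs (grph X)" "edge_germ q e = edge_germ q' e"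
  shows "emap q e = emap q' e" "emor q e = emor q' e"
proof -
  show *: "emap q e = emap q' e"
    using assms(4) by (simp add: edge_germ_def)
  have "cmp C (emor q e) (minv (emor p e)) = cmp C (emor q' e) (minv (emor p e))"
    using assms(4) by (simp add: edge_germ_def)
  then show "emor q e = emor q' e"
    using M1_cancel_right[OF minv(1)[OF p_mor(6)[OF assms(3)]] M1_hom[OF Cov_mor(6)[OF assms(1,3)]]]
      M1_hom[OF Cov_mor(6)[OF assms(2,3)]] * by simp
qed

text \<open>
  Under the last two assumptions \<open>g\<close> is a deck transformation of \<open>p\<close> at the edge \<open>e\<close>.
\<close>

lemma edge_germ_comp_deck:
  assumes q: "q \<in> Cov" and g: "g \<in> goo_Aut C M1 X" and e: "e \<in> arcs (grph X)"
    and "emap p (emap g e) = emap p e" "cmp C (emor p (emap g e)) (emor g e) = emor p e"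
  shows "edge_germ (goo_comp q g) e = edge_germ q (emap g e)"
proof -
  note ge = Aut_mor(3)[OF g e]
  have "cmp C (emor g e) (minv (emor p e)) = minv (emor p (emap g e))"
  proof -
    have "cmp C (emor p (emap g e)) (cmp C (emor g e) (minv (emor p e))) = ident C (eobj X1 (emap p e))"
      using cmp_assoc[OF M1_hom[OF minv(1)[OF p_mor(6)[OF e]]] M1_hom[OF Aut_mor(6)[OF g e]] M1_hom[OF p_mor(6)[OF ge]]]
        minv(3)[OF p_mor(6)[OF e]] assms(5) by simp
    then show ?thesis
      using cmp_minv_cancel_left[OF M1_hom[OF M1_cmp[OF minv(1)[OF p_mor(6)[OF e]] Aut_mor(6)[OF g e]]] p_mor(6)[OF ge]]
        cmp_ident(1)[OF M1_hom[OF minv(1)[OF p_mor(6)[OF ge]]]] assms(4) by simp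
  qed
  then show ?thesis
    using cmp_assoc[OF M1_hom[OF minv(1)[OF p_mor(6)[OF e]]] M1_hom[OF Aut_mor(6)[OF g e]] M1_hom[OF Cov_mor(6)[OF \<open>q \<in> Cov\<close> ge]]]
      assms(4) by (simp add: edge_germ_def)
qed

text \<open>
  The deck transformation of \<open>p\<close> moving \<open>v\<close> to \<open>v'\<close> carries \<open>q\<close> to the required covering. Thus
  one lift of each vertex of \<open>X1\<close> sees all star germs over it.
\<close>

lemma star_germ_move:
  assumes q: "q \<in> Cov" and v: "v \<in> verts (grph X)" "v' \<in> verts (grph X)" "vmap p v = vmap p v'"
  shows "\<exists>q' \<in> Cov. star_germ q' v = star_germ q v'"
proof -
  obtain g where g: "g \<in> goo_Aut C M1 X" "vmap g v = v'"
    "\<And>v. v \<in> verts (grph X) \<Longrightarrow> vmap p (vmap g v) = vmap p v"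
    "\<And>e. e \<in> arcs (grph X) \<Longrightarrow> emap p (emap g e) = emap p e"
    "\<And>e. e \<in> arcs (grph X) \<Longrightarrow> cmp C (emor p (emap g e)) (emor g e) = emor p e"
    using goo_covering_lift[OF X_tree X1 p_cov p_cov v] by metis
  have "emap g ` out_arcs (grph X) v = out_arcs (grph X) v'"
    using Aut_covering[OF g(1)] v(1) g(2) unfolding goo_covering_def graph_covering_def bij_betw_def
    by metis
  then have "edge_germ q ` out_arcs (grph X) v' = (\<lambda>e. edge_germ q (emap g e)) ` out_arcs (grph X) v"
    by (metis image_image)
  also have "\<dots> = edge_germ (goo_comp q g) ` out_arcs (grph X) v"
    using edge_germ_comp_deck[OF q g(1)] g(4,5) by (intro image_cong) auto
  finally have "star_germ (goo_comp q g) v = star_germ q v'"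
    using g(2) v(3) by (simp add: star_germ_def)
  then show ?thesis
    using Cov_comp_Aut[OF q g(1)] by blast
qed

text \<open>
  The edge germs in a star germ match the two stars bijectively, because both coverings are
  bijective on the star of \<open>v\<close>. This is what makes the glued complex a cover of both sides.
\<close>

lemma star_germ_bij:
  assumes "s \<in> star_germs"
  shows "snd (snd s) \<subseteq> edge_germs"
    and "bij_betw fst (snd (snd s)) (out_arcs (grph X1) (fst s))"
    and "bij_betw (fst \<circ> snd) (snd (snd s)) (out_arcs (grph X2) (fst (snd s)))"
    and "fst s \<in> verts (grph X1)" "fst (snd s) \<in> verts (grph X2)"
proof -
  obtain q v where s: "s = star_germ q v" "q \<in> Cov" "v \<in> verts (grph X)"
    using assms by (auto simp: star_germs_def)
  let ?S = "out_arcs (grph X) v"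
  show "snd (snd s) \<subseteq> edge_germs" "fst s \<in> verts (grph X1)" "fst (snd s) \<in> verts (grph X2)"
    using s edge_germ_in p_mor(1) Cov_mor(1) by (auto simp: star_germ_def)
  have "bij_betw (emap p) ?S (out_arcs (grph X1) (fst s))"
    "bij_betw (emap q) ?S (out_arcs (grph X2) (fst (snd s)))"
    using s p_cov CovD[OF s(2)] by (auto simp: goo_covering_def graph_covering_def star_germ_def)
  then have 1: "bij_betw (fst \<circ> edge_germ q) ?S (out_arcs (grph X1) (fst s))"
    and 2: "bij_betw (fst \<circ> snd \<circ> edge_germ q) ?S (out_arcs (grph X2) (fst (snd s)))"
    by (simp_all add: edge_germ_def comp_def)
  from 1 have "bij_betw (edge_germ q) ?S (snd (snd s))"
    unfolding s(1) star_germ_def bij_betw_def by (auto dest: inj_on_imageI2)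
  then show "bij_betw fst (snd (snd s)) (out_arcs (grph X1) (fst s))"
    "bij_betw (fst \<circ> snd) (snd (snd s)) (out_arcs (grph X2) (fst (snd s)))"
    using 1 2 bij_betw_comp_iff by blast+
qed

lemma star_germ_edge_unique:
  assumes "s \<in> star_germs" "t \<in> snd (snd s)" "t' \<in> snd (snd s)" "fst t = fst t'"
  shows "t = t'"
  using star_germ_bij(2)[OF assms(1)] assms(2-) by (auto simp: bij_betw_def dest: inj_onD)

lemma star_germ_edge_tail:
  assumes "s \<in> star_germs" "t \<in> snd (snd s)"
  shows "tail (grph X1) (fst t) = fst s" "tail (grph X2) (fst (snd t)) = fst (snd s)"
proof -
  have "fst t \<in> out_arcs (grph X1) (fst s)" "(fst \<circ> snd) t \<in> out_arcs (grph X2) (fst (snd s))"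
    using star_germ_bij(2,3)[OF assms(1)] assms(2) bij_betwE by blast+
  then show "tail (grph X1) (fst t) = fst s" "tail (grph X2) (fst (snd t)) = fst (snd s)" by auto
qed

lemma edge_germs_fixed_edge:
  assumes "t \<in> edge_germs" "e \<in> arcs (grph X)" "fst t = emap p e"
  shows "\<exists>q \<in> Cov. t = edge_germ q e"
proof -
  obtain q' e' where t: "t = edge_germ q' e'" "q' \<in> Cov" "e' \<in> arcs (grph X)"
    using assms(1) by (auto simp: edge_germs_def)
  let ?v = "tail (grph X) e" and ?v' = "tail (grph X) e'"
  have ee': "emap p e = emap p e'"
    using assms(3) t by (simp add: edge_germ_def)
  then have "vmap p ?v = vmap p ?v'"
    using p_mor(4) assms(2) t(3) by metis
  then obtain q where q: "q \<in> Cov" "star_germ q ?v = star_germ q' ?v'"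
    using star_germ_move[OF t(2) goo_arcs(1)[OF X assms(2)] goo_arcs(1)[OF X t(3)]] by blast
  have "t \<in> snd (snd (star_germ q ?v))"
    using t(3) unfolding q(2) t(1) by (auto simp: star_germ_def)
  moreover have "edge_germ q e \<in> snd (snd (star_germ q ?v))"
    using assms(2) by (auto simp: star_germ_def)
  ultimately have "t = edge_germ q e"
    using star_germ_edge_unique[OF star_germ_in[OF q(1) goo_arcs(1)[OF X assms(2)]]] assms(3)
    by simp
  then show ?thesis using q(1) by blast
qed

text \<open>
  The finiteness of the isotropy groups enters here. Fix an edge \<open>e\<close> of \<open>X\<close> over \<open>e1\<close> and one
  covering \<open>q0\<close> with value \<open>e2\<close> there. Any other such covering is \<open>q0 \<circ> g\<close> with \<open>g\<close> fixing \<open>e\<close>, so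
  that its germ at \<open>e\<close> is determined by an element of the isotropy group of \<open>e\<close>.
\<close>

lemma finite_edge_germs: "finite edge_germs"
proof -
  have fin: "finite {t \<in> edge_germs. fst t = e1 \<and> fst (snd t) = e2}" (is "finite ?T")
    if "e1 \<in> arcs (grph X1)" for e1 e2
  proof (cases "?T = {}")
    case False
    then obtain t0 where t0: "t0 \<in> edge_germs" "fst t0 = e1" "fst (snd t0) = e2" by blast
    obtain e where e: "e \<in> arcs (grph X)" "emap p e = e1"
      using goo_covering_simps(3)[OF p_cov \<open>e1 \<in> arcs (grph X1)\<close>] by blast
    obtain q0 where q0: "q0 \<in> Cov" "t0 = edge_germ q0 e"
      using edge_germs_fixed_edge[OF t0(1) e(1)] t0(2) e(2) by auto
    \<comment> \<open>The germ of \<open>q0 \<circ> g\<close> at \<open>e\<close>, as a function of the isotropy element \<open>m\<close> of \<open>g\<close>.\<close>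
    let ?F = "\<lambda>m. (e1, e2, cmp C (cmp C (emor q0 e) m) (minv (emor p e)))"
    have "?T \<subseteq> ?F ` edge_isotropy (goo_Aut C M1 X) e"
    proof
      fix t assume "t \<in> ?T"
      then have t: "t \<in> edge_germs" "fst t = e1" "fst (snd t) = e2" by auto
      obtain r where r: "r \<in> Cov" "t = edge_germ r e"
        using edge_germs_fixed_edge[OF t(1) e(1)] t(2) e(2) by auto
      have re: "emap r e = e2" "emap q0 e = e2"
        using t(3) r(2) t0(3) q0(2) by (simp_all add: edge_germ_def)
      let ?v = "tail (grph X) e"
      have "vmap r ?v = vmap q0 ?v"
        using re Cov_mor(4)[OF r(1) e(1)] Cov_mor(4)[OF q0(1) e(1)] by simp
      then obtain g where g: "g \<in> goo_Aut C M1 X" "vmap g ?v = ?v"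
        "emap q0 (emap g e) = emap r e" "cmp C (emor q0 (emap g e)) (emor g e) = emor r e"
        using goo_covering_lift[OF X_tree X2 CovD[OF r(1)] CovD[OF q0(1)]
            goo_arcs(1)[OF X e(1)] goo_arcs(1)[OF X e(1)]] e(1) by metis
      have "emap g e = e"
        using goo_covering_star_inj[OF CovD[OF q0(1)] X Aut_mor(3)[OF g(1) e(1)] e(1)]
          Aut_mor(4)[OF g(1) e(1)] g(2,3) re by simp
      then have "emor g e \<in> edge_isotropy (goo_Aut C M1 X) e" "t = ?F (emor g e)"
        using g(1,4) r(2) re e(2) by (auto simp: edge_isotropy_def edge_germ_def)
      then show "t \<in> ?F ` edge_isotropy (goo_Aut C M1 X) e" by blast
    qed
    moreover have "finite (edge_isotropy (goo_Aut C M1 X) e)"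
      using isotropy e(1) by (simp add: finite_edge_isotropy_def)
    ultimately show ?thesis
      using finite_surj by blast
  qed (metis finite.emptyI)
  have "edge_germs \<subseteq> (\<Union>e1 \<in> arcs (grph X1). \<Union>e2 \<in> arcs (grph X2).
      {t \<in> edge_germs. fst t = e1 \<and> fst (snd t) = e2})"
    using edge_germs_over by blast
  then show ?thesis
    by (rule finite_subset) (use finite_X1 finite_X2 fin in blast)
qed

lemma finite_star_germs: "finite star_germs"
proof (rule finite_subset)
  show "star_germs \<subseteq> verts (grph X1) \<times> verts (grph X2) \<times> Pow edge_germs"
  proof
    fix s assume "s \<in> star_germs"
    from star_germ_bij(1,4,5)[OF this]
    show "s \<in> verts (grph X1) \<times> verts (grph X2) \<times> Pow edge_germs"
      by (simp add: mem_Times_iff)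
  qed
  show "finite (verts (grph X1) \<times> verts (grph X2) \<times> Pow edge_germs)"
    using finite_X1 finite_X2 finite_edge_germs by simp
qed

text \<open>
  The right-hand side does not mention \<open>q\<close>: among automorphisms fixing \<open>v\<close>, equality of the star
  germs of \<open>q \<circ> g\<close> and \<open>q \<circ> h\<close> does not depend on the covering \<open>q\<close>. Hence \<open>q\<close> can be exchanged for
  another covering without merging star germs.
\<close>

lemma star_germ_comp_Aut_eq_iff:
  assumes q: "q \<in> Cov" and g: "g \<in> goo_Aut C M1 X" "h \<in> goo_Aut C M1 X"
    and v: "v \<in> verts (grph X)" "vmap g v = v" "vmap h v = v"
  shows "star_germ (goo_comp q g) v = star_germ (goo_comp q h) v \<longleftrightarrow>
    (\<forall>e \<in> out_arcs (grph X) v. emap g e = emap h e \<and> emor g e = emor h e)"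
proof
  assume eq: "star_germ (goo_comp q g) v = star_germ (goo_comp q h) v"
  show "\<forall>e \<in> out_arcs (grph X) v. emap g e = emap h e \<and> emor g e = emor h e"
  proof
    fix e assume "e \<in> out_arcs (grph X) v"
    then have e: "e \<in> arcs (grph X)" "tail (grph X) e = v" by auto
    note qg = Cov_comp_Aut[OF q g(1)] and qh = Cov_comp_Aut[OF q g(2)]
    have "edge_germ (goo_comp q g) e \<in> snd (snd (star_germ (goo_comp q g) v))"
      using e by (auto simp: star_germ_def)
    moreover have "edge_germ (goo_comp q h) e \<in> snd (snd (star_germ (goo_comp q g) v))"
      unfolding eq using e by (auto simp: star_germ_def)
    ultimately have "edge_germ (goo_comp q g) e = edge_germ (goo_comp q h) e"
      using star_germ_edge_unique[OF star_germ_in[OF qg v(1)]] by simp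
    note germ = edge_germ_eqD[OF qg qh e(1) this]
    have *: "emap g e = emap h e"
      using goo_covering_star_inj[OF CovD[OF q] X Aut_mor(3)[OF g(1) e(1)] Aut_mor(3)[OF g(2) e(1)]]
        Aut_mor(4)[OF g(1) e(1)] Aut_mor(4)[OF g(2) e(1)] e(2) v germ(1) by simp
    moreover have "emor g e = emor h e"
      using M1_cancel_left[OF M1_hom[OF Aut_mor(6)[OF g(1) e(1)]] _ Cov_mor(6)[OF q Aut_mor(3)[OF g(1) e(1)]]]
        M1_hom[OF Aut_mor(6)[OF g(2) e(1)]] germ(2) * by simp
    ultimately show "emap g e = emap h e \<and> emor g e = emor h e" by blast
  qed
next
  assume "\<forall>e \<in> out_arcs (grph X) v. emap g e = emap h e \<and> emor g e = emor h e"
  then have "edge_germ (goo_comp q g) ` out_arcs (grph X) v = edge_germ (goo_comp q h) ` out_arcs (grph X) v"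
    by (intro image_cong) (simp_all add: edge_germ_def)
  then show "star_germ (goo_comp q g) v = star_germ (goo_comp q h) v"
    using v by (simp add: star_germ_def)
qed

text \<open>
  Homogeneity; by symmetry the two numbers are equal. Write \<open>t\<close> and \<open>t'\<close> as the germs at one edge
  \<open>e\<close> of coverings \<open>q\<close> and \<open>q'\<close>. A star germ containing \<open>t\<close> belongs to a covering that agrees
  with \<open>q\<close> at \<open>e\<close>, that is, to \<open>q \<circ> g\<close> with \<open>g\<close> fixing \<open>e\<close> and trivial on its object. The star
  germ of \<open>q' \<circ> g\<close> then contains \<open>t'\<close>, and this assignment is injective.
\<close>

lemma card_star_germs_containing_le:
  assumes "t \<in> edge_germs" "t' \<in> edge_germs" "fst t = fst t'"
  shows "card {s \<in> star_germs. t \<in> snd (snd s)} \<le> card {s \<in> star_germs. t' \<in> snd (snd s)}"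
proof -
  obtain e where e: "e \<in> arcs (grph X)" "emap p e = fst t"
    using goo_covering_simps(3)[OF p_cov edge_germs_over(1)[OF assms(1)]] by blast
  let ?v = "tail (grph X) e"
  note v = goo_arcs(1)[OF X e(1)]
  obtain q q' where q: "q \<in> Cov" "t = edge_germ q e" and q': "q' \<in> Cov" "t' = edge_germ q' e"
    using edge_germs_fixed_edge[OF assms(1) e(1)] edge_germs_fixed_edge[OF assms(2) e(1)] assms(3) e(2)
    by metis
  have "\<exists>g. g \<in> goo_Aut C M1 X \<and> vmap g ?v = ?v \<and> s = star_germ (goo_comp q g) ?v \<and>
      emap g e = e \<and> emor g e = ident C (eobj X e)"
    if "s \<in> star_germs" "t \<in> snd (snd s)" for s
  proof -
    obtain r' v' where r': "s = star_germ r' v'" "r' \<in> Cov" "v' \<in> verts (grph X)"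
      using \<open>s \<in> star_germs\<close> by (auto simp: star_germs_def)
    have "vmap p ?v = vmap p v'"
      using star_germ_edge_tail(1)[OF that] p_mor(4)[OF e(1)] e(2) by (simp add: r' star_germ_def)
    then obtain r where r: "r \<in> Cov" "s = star_germ r ?v"
      using star_germ_move[OF r'(2) v r'(3)] r'(1) by auto
    have "edge_germ r e \<in> snd (snd s)"
      using e(1) by (simp add: r(2) star_germ_def)
    then have "edge_germ q e = edge_germ r e"
      using star_germ_edge_unique[OF that(1)] that(2) unfolding q(2) by simp
    note qr = edge_germ_eqD[OF q(1) r(1) e(1) this]
    have "vmap r ?v = vmap q ?v"
      using qr(1) goo_morphism_simps(4)[OF Cov[OF q(1)] e(1)] goo_morphism_simps(4)[OF Cov[OF r(1)] e(1)]
      by simp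
    then obtain g where g: "g \<in> goo_Aut C M1 X" "vmap g ?v = ?v"
      "\<And>e. e \<in> arcs (grph X) \<Longrightarrow> emap q (emap g e) = emap r e"
      "\<And>e. e \<in> arcs (grph X) \<Longrightarrow> cmp C (emor q (emap g e)) (emor g e) = emor r e"
      using goo_covering_lift[OF X_tree X2 CovD[OF r(1)] CovD[OF q(1)] v v] by metis
    have "edge_germ (goo_comp q g) ` out_arcs (grph X) ?v = edge_germ r ` out_arcs (grph X) ?v"
      using g(3,4) by (intro image_cong) (simp_all add: edge_germ_def)
    then have "s = star_germ (goo_comp q g) ?v"
      using r(2) g(2) \<open>vmap r ?v = vmap q ?v\<close> by (simp add: star_germ_def)
    moreover have ge: "emap g e = e"
      using goo_covering_star_inj[OF CovD[OF q(1)] X Aut_mor(3)[OF g(1) e(1)] e(1)]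
        Aut_mor(4)[OF g(1) e(1)] g(2) g(3)[OF e(1)] qr by simp
    moreover have "emor g e = ident C (eobj X e)"
    proof (rule M1_cancel_left)
      show "emor g e \<in> homset C (mors C) (eobj X e) (eobj X e)"
        using M1_hom[OF Aut_mor(6)[OF g(1) e(1)]] ge by simp
      show "ident C (eobj X e) \<in> homset C (mors C) (eobj X e) (eobj X e)"
        using ident_in_hom goo_simps(3)[OF X e(1)] by blast
      show qe: "emor q e \<in> homset C M1 (eobj X e) (eobj X2 (emap q e))"
        using goo_morphism_simps(6)[OF Cov[OF q(1)] e(1)] .
      show "cmp C (emor q e) (emor g e) = cmp C (emor q e) (ident C (eobj X e))"
        using g(4)[OF e(1)] ge qr(2) cmp_ident(1)[OF M1_hom[OF qe]] by simp
    qed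
    ultimately show ?thesis using g(1,2) by blast
  qed
  then obtain g where g: "\<And>s. s \<in> star_germs \<Longrightarrow> t \<in> snd (snd s) \<Longrightarrow>
      g s \<in> goo_Aut C M1 X \<and> vmap (g s) ?v = ?v \<and> s = star_germ (goo_comp q (g s)) ?v \<and>
      emap (g s) e = e \<and> emor (g s) e = ident C (eobj X e)"
    by metis
  let ?\<Phi> = "\<lambda>s. star_germ (goo_comp q' (g s)) ?v"
  show ?thesis
  proof (rule card_inj_on_le)
    show "inj_on ?\<Phi> {s \<in> star_germs. t \<in> snd (snd s)}"
    proof (rule inj_onI)
      fix s s' assume "s \<in> {s \<in> star_germs. t \<in> snd (snd s)}" "s' \<in> {s \<in> star_germs. t \<in> snd (snd s)}"
        and eq: "?\<Phi> s = ?\<Phi> s'"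
      then have s: "s \<in> star_germs" "t \<in> snd (snd s)" and s': "s' \<in> star_germs" "t \<in> snd (snd s')"
        by auto
      have "\<forall>e \<in> out_arcs (grph X) ?v. emap (g s) e = emap (g s') e \<and> emor (g s) e = emor (g s') e"
        using star_germ_comp_Aut_eq_iff[OF q'(1)] g[OF s] g[OF s'] v eq by blast
      then have "star_germ (goo_comp q (g s)) ?v = star_germ (goo_comp q (g s')) ?v"
        using star_germ_comp_Aut_eq_iff[OF q(1)] g[OF s] g[OF s'] v by blast
      then show "s = s'"
        using g[OF s] g[OF s'] by metis
    qed
    show "?\<Phi> ` {s \<in> star_germs. t \<in> snd (snd s)} \<subseteq> {s \<in> star_germs. t' \<in> snd (snd s)}"
    proof (rule image_subsetI)
      fix s assume "s \<in> {s \<in> star_germs. t \<in> snd (snd s)}"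
      then have "s \<in> star_germs" "t \<in> snd (snd s)" by auto
      note g = g[OF this]
      let ?g = "g s"
      have "edge_germ (goo_comp q' ?g) e = t'"
        using g q'(2) cmp_ident(1)[OF M1_hom[OF goo_morphism_simps(6)[OF Cov[OF q'(1)] e(1)]]]
        by (simp add: edge_germ_def)
      then have "t' \<in> snd (snd (?\<Phi> s))"
        using e(1) by (auto simp: star_germ_def)
      then show "?\<Phi> s \<in> {s \<in> star_germs. t' \<in> snd (snd s)}"
        using star_germ_in[OF Cov_comp_Aut[OF q'(1)] v] g by blast
    qed
    show "finite {s \<in> star_germs. t' \<in> snd (snd s)}"
      using finite_star_germs by simp
  qed
qed

definition germs_at :: "'v1 \<Rightarrow> ('v1 \<times> 'v2 \<times> ('e1 \<times> 'e2 \<times> 'm) set) set" where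
  "germs_at u = {s \<in> star_germs. fst s = u}"

definition germs_over :: "'e1 \<Rightarrow> ('e1 \<times> 'e2 \<times> 'm) set" where
  "germs_over d = {t \<in> edge_germs. fst t = d}"

text \<open>
  Each star germ over the initial vertex of an edge contains precisely one edge germ over that
  edge, and by homogeneity each of these is contained in the same number of star germs.
\<close>

lemma card_germs_at:
  assumes t: "t \<in> edge_germs"
  shows "card (germs_at (tail (grph X1) (fst t))) =
    card (germs_over (fst t)) * card {s \<in> star_germs. t \<in> snd (snd s)}"
proof -
  let ?d = "fst t"
  let ?S = "\<lambda>t. {s \<in> star_germs. t \<in> snd (snd s)}"
  have "germs_at (tail (grph X1) ?d) = (\<Union>t' \<in> germs_over ?d. ?S t')"
  proof (intro equalityI subsetI)
    fix s assume "s \<in> germs_at (tail (grph X1) ?d)"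
    then have s: "s \<in> star_germs" "?d \<in> out_arcs (grph X1) (fst s)"
      using edge_germs_over(1)[OF t] by (auto simp: germs_at_def)
    then obtain t' where "t' \<in> snd (snd s)" "fst t' = ?d"
      using star_germ_bij(2)[OF s(1)] by (metis bij_betw_imp_surj_on imageE)
    then show "s \<in> (\<Union>t' \<in> germs_over ?d. ?S t')"
      using s(1) star_germ_bij(1)[OF s(1)] by (intro UN_I[of t']) (auto simp: germs_over_def)
  qed (auto simp: germs_at_def germs_over_def dest: star_germ_edge_tail(1))
  moreover have "card (\<Union>t' \<in> germs_over ?d. ?S t') = (\<Sum>t' \<in> germs_over ?d. card (?S t'))"
    using finite_star_germs finite_edge_germs star_germ_edge_unique
    by (intro card_UN_disjoint) (auto simp: germs_over_def)
  moreover have "card (?S t') = card (?S t)" if "t' \<in> germs_over ?d" for t'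
    using card_star_germs_containing_le[of t t'] card_star_germs_containing_le[of t' t] that t
    by (auto simp: germs_over_def)
  ultimately show ?thesis by simp
qed

lemma finite_germs_at: "finite (germs_at u)"
  using finite_star_germs by (simp add: germs_at_def)

lemma germs_at_nonempty: "u \<in> verts (grph X1) \<Longrightarrow> germs_at u \<noteq> {}"
  using goo_covering_simps(2)[OF p_cov] Cov_nonempty star_germ_in
  by (fastforce simp: germs_at_def star_germ_def)

lemma card_germs_over_inv:
  assumes "d \<in> arcs (grph X1)"
  shows "card (germs_over (einv X1 d)) = card (germs_over d)"
proof (rule bij_betw_same_card[of germ_inv, symmetric], rule bij_betw_byWitness[of _ germ_inv])
  have "germ_inv t \<in> germs_over (einv X1 (fst t))" if "t \<in> edge_germs" for t
    using germ_inv_in[OF that] by (simp add: germs_over_def) (simp add: germ_inv_def)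
  then show "germ_inv ` germs_over d \<subseteq> germs_over (einv X1 d)"
    "germ_inv ` germs_over (einv X1 d) \<subseteq> germs_over d"
    using goo_arcs(4)[OF X1 assms] by (force simp: germs_over_def)+
qed (auto simp: germs_over_def germ_inv_germ_inv)

text \<open>
  The degree of the common cover over \<open>X1\<close>; all that matters is that every \<open>card (germs_at u)\<close>
  divides it.
\<close>

definition cover_degree :: nat where
  "cover_degree = (\<Prod>u \<in> verts (grph X1). card (germs_at u))"

lemma cover_degree_pos: "cover_degree > 0"
  unfolding cover_degree_def using finite_germs_at germs_at_nonempty by (intro prod_pos) (simp add: card_gt_0_iff)

text \<open>
  Over every vertex \<open>u\<close> the cover gets \<open>cover_degree\<close> many vertices, evenly labelled by star germs.
  The last clause says how often an edge germ then occurs: \<open>cover_degree\<close> divided by the number of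
  edge germs over the same edge, which is insensitive to reversing the edge.
\<close>

lemma balanced_labelling:
  "\<exists>l. (\<forall>u \<in> verts (grph X1). \<forall>i<cover_degree. l u i \<in> germs_at u) \<and>
    (\<forall>u \<in> verts (grph X1). \<forall>s \<in> germs_at u. \<exists>i<cover_degree. l u i = s) \<and>
    (\<forall>t \<in> edge_germs. card {i. i < cover_degree \<and> t \<in> snd (snd (l (tail (grph X1) (fst t)) i))} *
      card (germs_over (fst t)) = cover_degree)"
proof -
  have dvd: "card (germs_at u) dvd cover_degree" if "u \<in> verts (grph X1)" for u
    unfolding cover_degree_def using finite_X1(1) that by (rule dvd_prodI)
  have "\<forall>u \<in> verts (grph X1). \<exists>l. (\<forall>i<cover_degree. l i \<in> germs_at u) \<and>
      (\<forall>s \<in> germs_at u. card {i. i < cover_degree \<and> l i = s} = cover_degree div card (germs_at u))"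
  proof
    fix u assume "u \<in> verts (grph X1)"
    show "\<exists>l. (\<forall>i<cover_degree. l i \<in> germs_at u) \<and>
      (\<forall>s \<in> germs_at u. card {i. i < cover_degree \<and> l i = s} = cover_degree div card (germs_at u))"
      by (rule finite_equidistributed_labelling[OF finite_germs_at dvd[OF \<open>u \<in> _\<close>]]) blast
  qed
  from bchoice[OF this] obtain l where l: "\<And>u i. u \<in> verts (grph X1) \<Longrightarrow> i < cover_degree \<Longrightarrow> l u i \<in> germs_at u"
    "\<And>u s. u \<in> verts (grph X1) \<Longrightarrow> s \<in> germs_at u \<Longrightarrow>
      card {i. i < cover_degree \<and> l u i = s} = cover_degree div card (germs_at u)"
    by blast
  show ?thesis
  proof (intro exI[of _ l] conjI ballI allI impI)
    fix u s assume u: "u \<in> verts (grph X1)" and s: "s \<in> germs_at u"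
    have "card (germs_at u) > 0"
      using germs_at_nonempty[OF u] finite_germs_at by (simp add: card_gt_0_iff)
    then have "card {i. i < cover_degree \<and> l u i = s} > 0"
      using l(2)[OF u s] dvd[OF u] cover_degree_pos by (simp add: dvd_imp_le div_greater_zero_iff)
    then show "\<exists>i<cover_degree. l u i = s"
      by (auto simp: card_gt_0_iff)
  next
    fix t assume t: "t \<in> edge_germs"
    let ?u = "tail (grph X1) (fst t)" and ?S = "{s \<in> star_germs. t \<in> snd (snd s)}"
    have u: "?u \<in> verts (grph X1)"
      using goo_arcs(1)[OF X1 edge_germs_over(1)[OF t]] .
    have sub: "?S \<subseteq> germs_at ?u"
      unfolding germs_at_def using star_germ_edge_tail(1)[of _ t] by (metis (mono_tags, lifting) Collect_mono)
    have "{i. i < cover_degree \<and> t \<in> snd (snd (l ?u i))} = (\<Union>s \<in> ?S. {i. i < cover_degree \<and> l ?u i = s})"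
      using l(1)[OF u] by (auto simp: germs_at_def)
    also have "card \<dots> = (\<Sum>s \<in> ?S. card {i. i < cover_degree \<and> l ?u i = s})"
      using finite_star_germs by (intro card_UN_disjoint) auto
    also have "\<dots> = card ?S * (cover_degree div card (germs_at ?u))"
    proof -
      have "card {i. i < cover_degree \<and> l ?u i = s} = cover_degree div card (germs_at ?u)" if "s \<in> ?S" for s
        using l(2)[OF u] sub that by blast
      then show ?thesis by simp
    qed
    finally have "card {i. i < cover_degree \<and> t \<in> snd (snd (l ?u i))} * card (germs_over (fst t)) =
        card (germs_at ?u) * (cover_degree div card (germs_at ?u))"
      using card_germs_at[OF t] by simp
    then show "card {i. i < cover_degree \<and> t \<in> snd (snd (l ?u i))} * card (germs_over (fst t)) = cover_degree"
      using dvd[OF u] by simp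
  qed (use l(1) in blast)
qed

section \<open>Gluing star germs along edge germs\<close>

text \<open>
  Vertex morphisms are not recorded in star germs, since there may be infinitely many of them; any
  covering that induces the star germ supplies one that is compatible with all its edge germs.
\<close>

lemma star_germ_vertex_morphism:
  assumes "s \<in> star_germs"
  shows "\<exists>m \<in> homset C M1 (vobj X1 (fst s)) (vobj X2 (fst (snd s))).
    \<forall>t \<in> snd (snd s). cmp C m (phi0 X1 (fst t)) = cmp C (phi0 X2 (fst (snd t))) (snd (snd t))"
proof -
  obtain q v where s: "s = star_germ q v" "q \<in> Cov" "v \<in> verts (grph X)"
    using assms by (auto simp: star_germs_def)
  note qq = goo_morphism_simps[OF Cov[OF s(2)]]
  let ?m = "cmp C (vmor q v) (minv (vmor p v))"
  have "?m \<in> homset C M1 (vobj X1 (fst s)) (vobj X2 (fst (snd s)))"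
    using M1_cmp[OF minv(1)[OF p_mor(2)[OF s(3)]] qq(2)[OF s(3)]] s(1) by (simp add: star_germ_def)
  moreover have "cmp C ?m (phi0 X1 (fst t)) = cmp C (phi0 X2 (fst (snd t))) (snd (snd t))"
    if t: "t \<in> snd (snd s)" for t
  proof -
    obtain e where e: "t = edge_germ q e" "e \<in> arcs (grph X)" "tail (grph X) e = v"
      using t s(1) by (auto simp: star_germ_def)
    note pv = p_mor(2)[OF s(3)] and qv = qq(2)[OF s(3)] and pe = p_mor(6)[OF e(2)] and qe = qq(6)[OF e(2)]
    note \<phi> = goo_phi0_hom[OF X e(2), unfolded e(3)]
      and \<phi>1 = goo_phi0_hom[OF X1 p_mor(3)[OF e(2)], unfolded p_mor(4)[OF e(2)] e(3)]
      and \<phi>2 = goo_phi0_hom[OF X2 qq(3)[OF e(2)], unfolded qq(4)[OF e(2)] e(3)]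
    have "cmp C (minv (vmor p v)) (phi0 X1 (emap p e)) = cmp C (phi0 X e) (minv (emor p e))"
      using square_inverse[OF \<phi> \<phi>1 pv pe] p_mor(8)[OF e(2)] e(3) by simp
    then show ?thesis
      using square_paste[OF \<phi>1 \<phi> \<phi>2 minv(1)[OF pv] qv minv(1)[OF pe] qe] qq(8)[OF e(2)] e(3)
      by (simp add: e(1) edge_germ_def)
  qed
  ultimately show ?thesis by blast
qed

text \<open>
  The vertices over \<open>u\<close> are the pairs \<open>(u, i)\<close> with label \<open>l u i\<close>. An edge germ \<open>t\<close> gives rise to
  \<open>m t\<close> edges \<open>(t, j)\<close>, where \<open>m t\<close> is the number of vertices whose label contains \<open>t\<close>, and
  \<open>\<alpha> t\<close> distributes these edges over those vertices. As \<open>m\<close> is invariant under inversion of germs,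
  the copy \<open>j\<close> of \<open>t\<close> can be declared to be inverse to the copy \<open>j\<close> of the inverse germ. Objects
  are taken from \<open>X1\<close>; the covering of \<open>X2\<close> consists of the morphisms recorded in the germs.
\<close>

theorem common_finite_cover:
  "\<exists>Z :: ('v1 \<times> nat, ('e1 \<times> 'e2 \<times> 'm) \<times> nat, 'o, 'm) graph_of_objs.
    is_finite_graph_of_objs C M2 Z \<and> is_cover_of C M1 Z X1 \<and> is_cover_of C M1 Z X2"
proof -
  obtain l where l: "\<And>u i. u \<in> verts (grph X1) \<Longrightarrow> i < cover_degree \<Longrightarrow> l u i \<in> germs_at u"
    "\<And>u s. u \<in> verts (grph X1) \<Longrightarrow> s \<in> germs_at u \<Longrightarrow> \<exists>i<cover_degree. l u i = s"
    "\<And>t. t \<in> edge_germs \<Longrightarrow>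
      card {i. i < cover_degree \<and> t \<in> snd (snd (l (tail (grph X1) (fst t)) i))} * card (germs_over (fst t)) = cover_degree"
    using balanced_labelling by blast
  define I where "I t = {i. i < cover_degree \<and> t \<in> snd (snd (l (tail (grph X1) (fst t)) i))}" for t
  define m where "m t = card (I t)" for t
  have I_finite: "finite (I t)" for t by (simp add: I_def)
  have I_D: "i < cover_degree" "t \<in> snd (snd (l (tail (grph X1) (fst t)) i))" if "i \<in> I t" for i t
    using that by (auto simp: I_def)
  have m_inv: "m (germ_inv t) = m t" if t: "t \<in> edge_germs" for t
  proof -
    have "m (germ_inv t) * card (germs_over (fst t)) = m t * card (germs_over (fst t))"
      using l(3)[OF t] l(3)[OF germ_inv_in[OF t]] card_germs_over_inv[OF edge_germs_over(1)[OF t]]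
      by (simp add: m_def I_def) (simp add: germ_inv_def)
    then show ?thesis
      using l(3)[OF t] cover_degree_pos by (metis mult_0_right mult_cancel2 less_irrefl)
  qed
  obtain \<alpha> where \<alpha>: "bij_betw (\<alpha> t) {0..<m t} (I t)" for t
    using ex_bij_betw_nat_finite[OF I_finite] unfolding m_def by metis
  have \<alpha>_I: "\<alpha> t j \<in> I t" if "j < m t" for t j
    using bij_betwE[OF \<alpha>[of t]] that by auto
  obtain \<mu> where \<mu>: "\<And>s. s \<in> star_germs \<Longrightarrow> \<mu> s \<in> homset C M1 (vobj X1 (fst s)) (vobj X2 (fst (snd s)))"
    "\<And>s t. s \<in> star_germs \<Longrightarrow> t \<in> snd (snd s) \<Longrightarrow>
      cmp C (\<mu> s) (phi0 X1 (fst t)) = cmp C (phi0 X2 (fst (snd t))) (snd (snd t))"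
    using star_germ_vertex_morphism by metis
  define E where "E = Sigma edge_germs (\<lambda>t. {0..<m t})"
  define Z :: "('v1 \<times> nat, ('e1 \<times> 'e2 \<times> 'm) \<times> nat, 'o, 'm) graph_of_objs" where
    "Z = \<lparr>grph = \<lparr>verts = verts (grph X1) \<times> {0..<cover_degree}, arcs = E,
        tail = (\<lambda>(t, j). (tail (grph X1) (fst t), \<alpha> t j)),
        head = (\<lambda>(t, j). (head (grph X1) (fst t), \<alpha> (germ_inv t) j))\<rparr>,
      einv = (\<lambda>(t, j). if (t, j) \<in> E then (germ_inv t, j) else (t, j)),
      vobj = (\<lambda>(u, i). vobj X1 u), eobj = (\<lambda>(t, j). eobj X1 (fst t)),
      phi0 = (\<lambda>(t, j). phi0 X1 (fst t)), phi1 = (\<lambda>(t, j). phi1 X1 (fst t))\<rparr>"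
  have E_D: "t \<in> edge_germs" "j < m t" "\<alpha> t j \<in> I t" "\<alpha> t j < cover_degree" "(germ_inv t, j) \<in> E"
    "fst t \<in> arcs (grph X1)" "fst (snd t) \<in> arcs (grph X2)"
    if "(t, j) \<in> E" for t j
  proof -
    show t: "t \<in> edge_germs" "j < m t"
      using that by (simp_all add: E_def)
    show "\<alpha> t j \<in> I t" "\<alpha> t j < cover_degree"
      using \<alpha>_I[OF t(2)] I_D(1) by blast+
    show "(germ_inv t, j) \<in> E" "fst t \<in> arcs (grph X1)" "fst (snd t) \<in> arcs (grph X2)"
      using t germ_inv_in m_inv edge_germs_over by (simp_all add: E_def)
  qed
  have fst_inv: "fst (germ_inv t) = einv X1 (fst t)" "fst (snd (germ_inv t)) = einv X2 (fst (snd t))"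
    "snd (snd (germ_inv t)) = snd (snd t)" for t
    by (simp_all add: germ_inv_def)
  note X1_arcs = goo_arcs[OF X1 E_D(6)]
  have wf: "wf_digraph (grph Z)"
  proof unfold_locales
    fix a assume a: "a \<in> arcs (grph Z)"
    then obtain t j where tj: "a = (t, j)" "(t, j) \<in> E"
      by (cases a) (auto simp: Z_def)
    show "tail (grph Z) a \<in> verts (grph Z)" "head (grph Z) a \<in> verts (grph Z)"
      using tj X1_arcs[OF tj(2)] E_D[OF tj(2)] E_D(4)[OF E_D(5)[OF tj(2)]]
      by (simp_all add: Z_def)
  qed
  have "finite E"
    by (simp add: E_def finite_edge_germs)
  then have "fin_digraph (grph Z)"
    using wf finite_X1 by (intro wf_digraph.fin_digraphI) (auto simp: Z_def)
  moreover have bidir: "bidirected_digraph (grph Z) (einv Z)"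
  proof (rule wf_digraph.bidirected_digraphI[OF wf])
    fix a assume a: "a \<in> arcs (grph Z)"
    then obtain t j where tj: "a = (t, j)" "(t, j) \<in> E"
      by (cases a) (auto simp: Z_def)
    show "einv Z a \<noteq> a"
      using tj fst_inv(1)[of t] bidirected_digraph.arev_neq[OF goo_simps(1)[OF X1] E_D(6)[OF tj(2)]]
      by (auto simp: Z_def)
    show "einv Z (einv Z a) = a" "tail (grph Z) (einv Z a) = head (grph Z) a"
      using tj E_D[OF tj(2)] X1_arcs[OF tj(2)] by (simp_all add: Z_def germ_inv_germ_inv fst_inv)
  qed (auto simp: Z_def)
  moreover have Z: "is_graph_of_objs C M2 Z"
  proof (rule is_graph_of_objsI[OF bidir])
    fix a assume a: "a \<in> arcs (grph Z)"
    then obtain t j where tj: "a = (t, j)" "(t, j) \<in> E"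
      by (cases a) (auto simp: Z_def)
    show "eobj Z a \<in> objs C" "eobj Z (einv Z a) = eobj Z a"
      "phi0 Z a \<in> homset C M2 (eobj Z a) (vobj Z (tail (grph Z) a))" "phi1 Z a = phi0 Z (einv Z a)"
      using tj goo_simps[OF X1] E_D(6)[OF tj(2)] by (simp_all add: Z_def fst_inv)
  qed (use goo_simps(2)[OF X1] in \<open>auto simp: Z_def\<close>)
  ultimately have "is_finite_graph_of_objs C M2 Z"
    by (simp add: is_finite_graph_of_objs_def)
  \<comment> \<open>Injectivity on stars, for both projections at once.\<close>
  have tail_unique: "(t, j) = (t', j')" if "(t, j) \<in> E" "(t', j') \<in> E"
    "tail (grph X1) (fst t) = tail (grph X1) (fst t')" "\<alpha> t j = \<alpha> t' j'"
    "fst t = fst t' \<or> fst (snd t) = fst (snd t')" for t j t' j'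
  proof -
    let ?s = "l (tail (grph X1) (fst t)) (\<alpha> t j)"
    have "?s \<in> germs_at (tail (grph X1) (fst t))"
      using l(1) E_D(4)[OF that(1)] X1_arcs(1)[OF that(1)] by blast
    then have s: "?s \<in> star_germs" by (simp add: germs_at_def)
    have t: "t \<in> snd (snd ?s)" "t' \<in> snd (snd ?s)"
      using I_D(2)[OF E_D(3)[OF that(1)]] I_D(2)[OF E_D(3)[OF that(2)]] that(3,4) by simp_all
    have "t = t'"
      using that(5)
    proof
      assume "fst t = fst t'"
      then show ?thesis using star_germ_edge_unique[OF s t] by blast
    next
      assume "fst (snd t) = fst (snd t')"
      then show ?thesis
        using inj_onD[OF bij_betw_imp_inj_on[OF star_germ_bij(3)[OF s]] _ t] by simp
    qed
    moreover have "j = j'"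
      using bij_betw_imp_inj_on[OF \<alpha>[of t]] E_D(2)[OF that(1)] E_D(2)[OF that(2)] that(4) \<open>t = t'\<close>
      by (auto dest: inj_onD)
    ultimately show ?thesis by simp
  qed
  \<comment> \<open>Surjectivity on stars, for both projections at once.\<close>
  have tail_ex: "\<exists>j. (t, j) \<in> E \<and> \<alpha> t j = i"
    if "u \<in> verts (grph X1)" "i < cover_degree" "t \<in> snd (snd (l u i))" for u i t
  proof -
    have s: "l u i \<in> star_germs" "fst (l u i) = u"
      using l(1)[OF that(1,2)] by (auto simp: germs_at_def)
    then have "t \<in> edge_germs" "tail (grph X1) (fst t) = u"
      using star_germ_bij(1)[OF s(1)] star_germ_edge_tail(1)[OF s(1) that(3)] s(2) that(3) by auto
    moreover from this have "i \<in> I t"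
      using that by (simp add: I_def)
    then have "i \<in> \<alpha> t ` {0..<m t}"
      using bij_betw_imp_surj_on[OF \<alpha>] by simp
    ultimately show ?thesis
      by (auto simp: E_def)
  qed
  have arc_ex: "\<exists>j. (t, j) \<in> E" if t: "t \<in> edge_germs" for t
  proof -
    have "m t \<noteq> 0"
      using l(3)[OF t] cover_degree_pos unfolding m_def I_def by (metis mult_0 less_irrefl)
    then show ?thesis
      using t by (auto simp: E_def intro: exI[of _ 0])
  qed
  have "is_cover_of C M1 Z X1"
  proof -
    define f where "f = \<lparr>vmap = fst, emap = fst \<circ> fst, vmor = (\<lambda>x. ident C (vobj Z x)),
      emor = (\<lambda>a. ident C (eobj Z a))\<rparr>"
    have "goo_covering C M1 Z X1 f"
    proof (rule goo_coveringI)
      show "goo_morphism C M1 Z X1 f"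
      proof (rule goo_morphismI[OF Z X1])
        fix x assume "x \<in> verts (grph Z)"
        then show "vmor f x \<in> homset C M1 (vobj Z x) (vobj X1 (vmap f x))"
          using M1_ident goo_simps(2)[OF X1] by (auto simp: Z_def f_def)
      next
        fix a assume a: "a \<in> arcs (grph Z)"
        then obtain t j where tj: "a = (t, j)" "(t, j) \<in> E"
          by (cases a) (auto simp: Z_def)
        show "emor f a \<in> homset C M1 (eobj Z a) (eobj X1 (emap f a))"
          "cmp C (vmor f (tail (grph Z) a)) (phi0 Z a) = cmp C (phi0 X1 (emap f a)) (emor f a)"
          using tj M1_ident goo_simps(3)[OF X1] E_D(6)[OF tj(2)]
            cmp_ident[OF goo_phi0_hom[OF X1 E_D(6)[OF tj(2)]]]
          by (simp_all add: Z_def f_def)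
        show "emap f (einv Z a) = einv X1 (emap f a)" "emor f (einv Z a) = emor f a"
          using tj E_D[OF tj(2)] goo_simps(4)[OF X1] by (simp_all add: Z_def f_def fst_inv)
        show "emap f a \<in> arcs (grph X1)" "tail (grph X1) (emap f a) = vmap f (tail (grph Z) a)"
          using tj E_D[OF tj(2)] by (simp_all add: Z_def f_def)
      qed (auto simp: Z_def f_def)
      show "v \<in> vmap f ` verts (grph Z)" if "v \<in> verts (grph X1)" for v
        using that cover_degree_pos by (auto simp: Z_def f_def)
      show "d \<in> emap f ` arcs (grph Z)" if "d \<in> arcs (grph X1)" for d
      proof -
        obtain e where e: "e \<in> arcs (grph X)" "emap p e = d"
          using goo_covering_simps(3)[OF p_cov \<open>d \<in> arcs (grph X1)\<close>] by blast
        obtain q where "q \<in> Cov" using Cov_nonempty by blast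
        then obtain j where "(edge_germ q e, j) \<in> E"
          using arc_ex[OF edge_germ_in[OF _ e(1)]] by blast
        then show ?thesis
          using e(2) by (force simp: Z_def f_def edge_germ_def image_iff)
      qed
      show "a = b" if "a \<in> arcs (grph Z)" "b \<in> arcs (grph Z)" "tail (grph Z) a = tail (grph Z) b"
        "emap f a = emap f b" for a b
        using that tail_unique by (cases a, cases b) (simp add: Z_def f_def)
      show "\<exists>a \<in> arcs (grph Z). tail (grph Z) a = x \<and> emap f a = d"
        if x: "x \<in> verts (grph Z)" and d: "d \<in> arcs (grph X1)" "tail (grph X1) d = vmap f x" for x d
      proof -
        obtain u i where ui: "x = (u, i)" "u \<in> verts (grph X1)" "i < cover_degree"
          using x by (cases x) (auto simp: Z_def)
        then have s: "l u i \<in> star_germs" "fst (l u i) = u"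
          using l(1)[OF ui(2,3)] by (auto simp: germs_at_def)
        then have "d \<in> fst ` snd (snd (l u i))"
          using bij_betw_imp_surj_on[OF star_germ_bij(2)[OF s(1)]] d ui(1) by (simp add: f_def)
        then obtain t where t: "t \<in> snd (snd (l u i))" "fst t = d" by blast
        obtain j where "(t, j) \<in> E" "\<alpha> t j = i"
          using tail_ex[OF ui(2,3) t(1)] by blast
        then show ?thesis
          using t(2) d(2) ui(1) by (intro bexI[of _ "(t, j)"]) (simp_all add: Z_def f_def)
      qed
    qed
    then show ?thesis by (auto simp: is_cover_of_def)
  qed
  moreover have "is_cover_of C M1 Z X2"
  proof -
    define f :: "('v1 \<times> nat, ('e1 \<times> 'e2 \<times> 'm) \<times> nat, 'v2, 'e2, 'm) goo_map" where
      "f = \<lparr>vmap = (\<lambda>(u, i). fst (snd (l u i))), emap = (\<lambda>(t, j). fst (snd t)),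
      vmor = (\<lambda>(u, i). \<mu> (l u i)), emor = (\<lambda>(t, j). snd (snd t))\<rparr>"
    have l_germ: "l u i \<in> star_germs" "fst (l u i) = u" if "u \<in> verts (grph X1)" "i < cover_degree" for u i
      using l(1)[OF that] by (auto simp: germs_at_def)
    have l_arc: "t \<in> snd (snd (l (tail (grph X1) (fst t)) (\<alpha> t j)))" if "(t, j) \<in> E" for t j
      using I_D(2)[OF E_D(3)[OF that]] .
    have l_arc_germ: "l (tail (grph X1) (fst t)) (\<alpha> t j) \<in> star_germs" if "(t, j) \<in> E" for t j
      using l_germ(1)[OF X1_arcs(1)[OF that] E_D(4)[OF that]] .
    have "goo_covering C M1 Z X2 f"
    proof (rule goo_coveringI)
      show "goo_morphism C M1 Z X2 f"
      proof (rule goo_morphismI[OF Z X2])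
        fix x assume "x \<in> verts (grph Z)"
        then obtain u i where ui: "x = (u, i)" "u \<in> verts (grph X1)" "i < cover_degree"
          by (cases x) (auto simp: Z_def)
        show "vmap f x \<in> verts (grph X2)" "vmor f x \<in> homset C M1 (vobj Z x) (vobj X2 (vmap f x))"
          using ui star_germ_bij(5)[OF l_germ(1)[OF ui(2,3)]] \<mu>(1)[OF l_germ(1)[OF ui(2,3)]]
            l_germ(2)[OF ui(2,3)] by (simp_all add: Z_def f_def)
      next
        fix a assume a: "a \<in> arcs (grph Z)"
        then obtain t j where tj: "a = (t, j)" "(t, j) \<in> E"
          by (cases a) (auto simp: Z_def)
        note s = l_arc_germ[OF tj(2)] l_arc[OF tj(2)]
        show "tail (grph X2) (emap f a) = vmap f (tail (grph Z) a)"
          "cmp C (vmor f (tail (grph Z) a)) (phi0 Z a) = cmp C (phi0 X2 (emap f a)) (emor f a)"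
          "emor f a \<in> homset C M1 (eobj Z a) (eobj X2 (emap f a))" "emap f a \<in> arcs (grph X2)"
          using tj E_D[OF tj(2)] \<mu>(2)[OF s] star_germ_edge_tail(2)[OF s]
            edge_germs_over(3)[OF E_D(1)[OF tj(2)]]
          by (simp_all add: Z_def f_def)
        show "emap f (einv Z a) = einv X2 (emap f a)" "emor f (einv Z a) = emor f a"
          using tj by (simp_all add: Z_def f_def fst_inv)
      qed
      show "w \<in> vmap f ` verts (grph Z)" if w: "w \<in> verts (grph X2)" for w
      proof -
        obtain q where q: "q \<in> Cov" using Cov_nonempty by blast
        obtain v where v: "v \<in> verts (grph X)" "vmap q v = w"
          using goo_covering_simps(2)[OF CovD[OF q] w] by blast
        have "star_germ q v \<in> germs_at (vmap p v)"
          using star_germ_in[OF q v(1)] by (simp add: germs_at_def star_germ_def)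
        then obtain i where "i < cover_degree" "l (vmap p v) i = star_germ q v"
          using l(2)[OF p_mor(1)[OF v(1)]] by blast
        then show ?thesis
          using v p_mor(1)[OF v(1)] by (intro image_eqI[of _ _ "(vmap p v, i)"]) (simp_all add: Z_def f_def star_germ_def)
      qed
      show "d \<in> emap f ` arcs (grph Z)" if d: "d \<in> arcs (grph X2)" for d
      proof -
        obtain q where q: "q \<in> Cov" using Cov_nonempty by blast
        obtain e where e: "e \<in> arcs (grph X)" "emap q e = d"
          using goo_covering_simps(3)[OF CovD[OF q] d] by blast
        obtain j where "(edge_germ q e, j) \<in> E"
          using arc_ex[OF edge_germ_in[OF q e(1)]] by blast
        then show ?thesis
          using e(2) by (force simp: Z_def f_def edge_germ_def image_iff)
      qed
      show "a = b" if "a \<in> arcs (grph Z)" "b \<in> arcs (grph Z)" "tail (grph Z) a = tail (grph Z) b"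
        "emap f a = emap f b" for a b
        using that tail_unique by (cases a, cases b) (simp add: Z_def f_def)
      show "\<exists>a \<in> arcs (grph Z). tail (grph Z) a = x \<and> emap f a = d"
        if x: "x \<in> verts (grph Z)" and d: "d \<in> arcs (grph X2)" "tail (grph X2) d = vmap f x" for x d
      proof -
        obtain u i where ui: "x = (u, i)" "u \<in> verts (grph X1)" "i < cover_degree"
          using x by (cases x) (auto simp: Z_def)
        note s = l_germ[OF ui(2,3)]
        have "d \<in> (fst \<circ> snd) ` snd (snd (l u i))"
          using bij_betw_imp_surj_on[OF star_germ_bij(3)[OF s(1)]] d ui(1) by (simp add: f_def)
        then obtain t where t: "t \<in> snd (snd (l u i))" "fst (snd t) = d" by auto
        obtain j where "(t, j) \<in> E" "\<alpha> t j = i"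
          using tail_ex[OF ui(2,3) t(1)] by blast
        then show ?thesis
          using t ui(1) star_germ_edge_tail(1)[OF s(1) t(1)] s(2)
          by (intro bexI[of _ "(t, j)"]) (simp_all add: Z_def f_def)
      qed
    qed
    then show ?thesis by (auto simp: is_cover_of_def)
  qed
  ultimately show ?thesis
    using \<open>is_finite_graph_of_objs C M2 Z\<close> by blast
qed

end

theorem theorem1p3:
  fixes C :: "('o, 'm) category" and M1 M2 :: "'m set"
    and X1 :: "('v1, 'e1, 'o, 'm) graph_of_objs"
    and X2 :: "('v2, 'e2, 'o, 'm) graph_of_objs"
    and X :: "('v, 'e, 'o, 'm) graph_of_objs"
  assumes "category_triple C M1 M2"
    and "is_finite_graph_of_objs C M2 X1"
    and "is_finite_graph_of_objs C M2 X2"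
    and "is_tree_of_objs C M2 X"
    and "is_cover_of C M1 X X1"
    and "is_cover_of C M1 X X2"
    and "finite_edge_isotropy X (goo_Aut C M1 X)"
  shows "\<exists>Z :: (nat, nat, 'o, 'm) graph_of_objs.
           is_finite_graph_of_objs C M2 Z \<and>
           is_cover_of C M1 Z X1 \<and>
           is_cover_of C M1 Z X2"
proof -
  interpret category_triple C M1 M2 by fact
  obtain p where "goo_covering C M1 X X1 p"
    using assms(5) by (auto simp: is_cover_of_def)
  then interpret two_covered_goos C M1 M2 X1 X2 X p
    by unfold_locales (use assms in auto)
  obtain Z :: "('v1 \<times> nat, ('e1 \<times> 'e2 \<times> 'm) \<times> nat, 'o, 'm) graph_of_objs" and f1 f2
    where Z: "is_finite_graph_of_objs C M2 Z" "goo_covering C M1 Z X1 f1" "goo_covering C M1 Z X2 f2"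
    using common_finite_cover unfolding is_cover_of_def by blast
  obtain Z' :: "(nat, nat, 'o, 'm) graph_of_objs" and f
    where Z': "is_finite_graph_of_objs C M2 Z'" "goo_covering C M1 Z' Z f"
    using finite_goo_copy_on_nat[OF Z(1)] by blast
  have "is_graph_of_objs C M2 Z" "is_graph_of_objs C M2 Z'"
    using Z(1) Z'(1) by (auto simp: is_finite_graph_of_objs_def)
  then have "is_cover_of C M1 Z' X1" "is_cover_of C M1 Z' X2"
    using goo_covering_comp[OF _ _ _ Z'(2)] Z(2,3) X1 X2 unfolding is_cover_of_def by blast+
  then show ?thesis
    using Z'(1) by blast
qed

end
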